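(* Bounded Extension Roman Domination, parameterized by $|h^{-1}(0)|$, is W[1]-hard, even when restricted to bipartite graphs.
   Context: For a graph $G=(V,E)$, a function $g:V\to\{0,1,2\}$ is a Roman dominating function (rdf) if every $v$ with $g(v)=0$ has a neighbor $u$ with $g(u)=2$. Functions are ordered pointwise; an rdf $g$ is minimal if every rdf $g'\le g$ equals $g$. Bounded Extension Roman Domination: given a graph $G=(V,E)$ and functions $f,h:V\to\{0,1,2\}$, decide whether there is a minimal rdf $g$ with $f\le g\le h$. *)

theory Defs
  imports Main
begin

section \<open>Machine model\<close>

text \<open>
  The model of computation is the WHILE language over binary trees (N. D. Jones, Computability and
  Complexity from a Programming Perspective, 1997); trees play the role of words over a finite
  alphabet. In contrast to the unit-cost measure, an assignment is charged with the size of the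
  value it stores. Sharing therefore cannot create large values cheaply: in time \<open>t\<close> no variable
  grows beyond the input size plus \<open>t\<close>, and the measure is polynomially related to the
  running time of multi-tape Turing machines in both directions.
\<close>

datatype tree = Leaf | Node tree tree

primrec tsize :: "tree \<Rightarrow> nat" where
  "tsize Leaf = 1"
| "tsize (Node a b) = 1 + tsize a + tsize b"

fun left :: "tree \<Rightarrow> tree" where
  "left Leaf = Leaf"
| "left (Node a b) = a"

fun right :: "tree \<Rightarrow> tree" where
  "right Leaf = Leaf"
| "right (Node a b) = b"

datatype expr = Var nat | ELeaf | ENode expr expr | ELeft expr | ERight expr

type_synonym state = "nat \<Rightarrow> tree"

primrec val :: "expr \<Rightarrow> state \<Rightarrow> tree" where
  "val (Var i) s = s i"
| "val ELeaf s = Leaf"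
| "val (ENode a b) s = Node (val a s) (val b s)"
| "val (ELeft a) s = left (val a s)"
| "val (ERight a) s = right (val a s)"

datatype prog =
    Assign nat expr
  | Seq prog prog
  | Cond expr prog prog
  | While expr prog

text \<open>\<open>exec c s t s'\<close>: program \<open>c\<close> started in \<open>s\<close> halts in \<open>s'\<close> after time \<open>t\<close>.
  A test succeeds iff its value is not \<open>Leaf\<close>.\<close>

inductive exec :: "prog \<Rightarrow> state \<Rightarrow> nat \<Rightarrow> state \<Rightarrow> bool" where
  Assign: "exec (Assign i e) s (1 + tsize (val e s)) (s(i := val e s))"
| Seq: "exec c1 s t1 s1 \<Longrightarrow> exec c2 s1 t2 s2 \<Longrightarrow> exec (Seq c1 c2) s (t1 + t2) s2"
| CondTrue: "val e s \<noteq> Leaf \<Longrightarrow> exec c1 s t s' \<Longrightarrow> exec (Cond e c1 c2) s (1 + t) s'"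
| CondFalse: "val e s = Leaf \<Longrightarrow> exec c2 s t s' \<Longrightarrow> exec (Cond e c1 c2) s (1 + t) s'"
| WhileFalse: "val e s = Leaf \<Longrightarrow> exec (While e c) s 1 s"
| WhileTrue: "val e s \<noteq> Leaf \<Longrightarrow> exec c s t1 s1 \<Longrightarrow> exec (While e c) s1 t2 s2
    \<Longrightarrow> exec (While e c) s (1 + t1 + t2) s2"

definition runs :: "prog \<Rightarrow> tree \<Rightarrow> nat \<Rightarrow> tree \<Rightarrow> bool" where
  "runs c x t y \<longleftrightarrow> (\<exists>s'. exec c ((\<lambda>_. Leaf)(0 := x)) t s' \<and> s' 0 = y)"

section \<open>Encodings\<close>

primrec num :: "nat \<Rightarrow> tree" where
  "num 0 = Leaf"
| "num (Suc n) = Node Leaf (num n)"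

primrec enc_list :: "tree list \<Rightarrow> tree" where
  "enc_list [] = Leaf"
| "enc_list (x # xs) = Node x (enc_list xs)"

definition enc_nats :: "nat list \<Rightarrow> tree" where
  "enc_nats ns = enc_list (map num ns)"

definition enc_pairs :: "(nat \<times> nat) list \<Rightarrow> tree" where
  "enc_pairs ps = enc_list (map (\<lambda>(u, v). Node (num u) (num v)) ps)"

section \<open>Parameterized problems and fpt reductions\<close>

definition computable :: "(nat \<Rightarrow> nat) \<Rightarrow> bool" where
  "computable f \<longleftrightarrow> (\<exists>p. \<forall>n. \<exists>t. runs p (num n) t (num (f n)))"

type_synonym problem = "(tree \<times> nat) set"

text \<open>\<open>I\<close> is the class of instances of the target problem that the reduction has to map into.\<close>

definition fpt_reduces_into :: "problem \<Rightarrow> (tree \<times> nat) set \<Rightarrow> problem \<Rightarrow> bool" where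
  "fpt_reduces_into L I Q \<longleftrightarrow>
    (\<exists>p f g c. computable f \<and> computable g \<and>
      (\<forall>x k. \<exists>x' k' t.
        runs p (Node x (num k)) t (Node x' (num k')) \<and>
        t \<le> f k * tsize x ^ c \<and>
        k' \<le> g k \<and>
        (x', k') \<in> I \<and>
        ((x, k) \<in> L \<longleftrightarrow> (x', k') \<in> Q)))"

definition fpt_reduces :: "problem \<Rightarrow> problem \<Rightarrow> bool" where
  "fpt_reduces L Q \<longleftrightarrow> fpt_reduces_into L UNIV Q"

section \<open>Weighted circuit satisfiability and the W-hierarchy\<close>

text \<open>
  A circuit consists of \<open>n\<close> inputs and a list of gates in topological order. Nodes \<open>0, \<dots>, n - 1\<close>
  are the inputs, node \<open>n + j\<close> is the \<open>j\<close>-th gate, and the last node is the output.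
\<close>

datatype gate = GNot nat | GAnd "nat list" | GOr "nat list"

primrec fan_in :: "gate \<Rightarrow> nat list" where
  "fan_in (GNot i) = [i]"
| "fan_in (GAnd is) = is"
| "fan_in (GOr is) = is"

record circuit =
  inputs :: nat
  gates :: "gate list"

definition wf_circuit :: "circuit \<Rightarrow> bool" where
  "wf_circuit C \<longleftrightarrow> inputs C + length (gates C) > 0 \<and>
    (\<forall>j < length (gates C). fan_in (gates C ! j) \<noteq> [] \<and>
      (\<forall>i \<in> set (fan_in (gates C ! j)). i < inputs C + j))"

text \<open>Attributes of all nodes, where \<open>\<phi> vs\<close> yields the attribute of a gate from the list \<open>vs\<close> of
  the attributes of the preceding nodes.\<close>

definition node_attrs :: "('a list \<Rightarrow> gate \<Rightarrow> 'a) \<Rightarrow> (nat \<Rightarrow> 'a) \<Rightarrow> circuit \<Rightarrow> 'a list" where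
  "node_attrs \<phi> a C =
    foldl (\<lambda>vs g. vs @ [\<phi> vs g]) (map a [0..<inputs C]) (gates C)"

primrec gate_val :: "bool list \<Rightarrow> gate \<Rightarrow> bool" where
  "gate_val vs (GNot i) = (\<not> vs ! i)"
| "gate_val vs (GAnd is) = (\<forall>i\<in>set is. vs ! i)"
| "gate_val vs (GOr is) = (\<exists>i\<in>set is. vs ! i)"

text \<open>The set \<open>A\<close> contains the inputs that are assigned true.\<close>

definition satisfies :: "nat set \<Rightarrow> circuit \<Rightarrow> bool" where
  "satisfies A C \<longleftrightarrow> last (node_attrs gate_val (\<lambda>i. i \<in> A) C)"

text \<open>Maximum weight of a path from an input to the output, where inputs have weight 0.\<close>

definition max_path :: "(gate \<Rightarrow> nat) \<Rightarrow> circuit \<Rightarrow> nat" where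
  "max_path w C =
    last (node_attrs (\<lambda>vs g. w g + Max ((\<lambda>i. vs ! i) ` set (fan_in g))) (\<lambda>_. 0) C)"

definition depth :: "circuit \<Rightarrow> nat" where
  "depth C = max_path (\<lambda>_. 1) C"

definition weft :: "circuit \<Rightarrow> nat" where
  "weft C = max_path (\<lambda>g. if length (fan_in g) > 2 then 1 else 0) C"

primrec enc_gate :: "gate \<Rightarrow> tree" where
  "enc_gate (GNot i) = Node (num 0) (num i)"
| "enc_gate (GAnd is) = Node (num 1) (enc_nats is)"
| "enc_gate (GOr is) = Node (num 2) (enc_nats is)"

definition enc_circuit :: "circuit \<Rightarrow> tree" where
  "enc_circuit C = Node (num (inputs C)) (enc_list (map enc_gate (gates C)))"

definition WCS :: "nat \<Rightarrow> nat \<Rightarrow> problem" where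
  "WCS t d = {(enc_circuit C, k) | C k.
    wf_circuit C \<and> weft C \<le> t \<and> depth C \<le> d \<and>
    (\<exists>A \<subseteq> {..<inputs C}. card A = k \<and> satisfies A C)}"

definition W :: "nat \<Rightarrow> problem set" where
  "W t = {L. \<exists>d \<ge> 1. fpt_reduces L (WCS t d)}"

definition W_hard :: "nat \<Rightarrow> problem \<Rightarrow> bool" where
  "W_hard t Q \<longleftrightarrow> (\<forall>L \<in> W t. fpt_reduces L Q)"

text \<open>Hardness of \<open>Q\<close> restricted to the instances in \<open>I\<close>.\<close>

definition W_hard_on :: "nat \<Rightarrow> (tree \<times> nat) set \<Rightarrow> problem \<Rightarrow> bool" where
  "W_hard_on t I Q \<longleftrightarrow> (\<forall>L \<in> W t. fpt_reduces_into L I Q)"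

section \<open>Roman domination\<close>

text \<open>Edges are two-element vertex sets. Functions on \<open>V\<close> are compared on \<open>V\<close> only.\<close>

definition bipartite :: "'a set \<Rightarrow> 'a set set \<Rightarrow> bool" where
  "bipartite V E \<longleftrightarrow> (\<exists>A B. A \<union> B = V \<and> A \<inter> B = {} \<and>
    (\<forall>e\<in>E. \<exists>a\<in>A. \<exists>b\<in>B. e = {a, b}))"

definition rdf :: "'a set \<Rightarrow> 'a set set \<Rightarrow> ('a \<Rightarrow> nat) \<Rightarrow> bool" where
  "rdf V E g \<longleftrightarrow> g ` V \<subseteq> {0, 1, 2} \<and>
    (\<forall>v\<in>V. g v = 0 \<longrightarrow> (\<exists>u\<in>V. {v, u} \<in> E \<and> g u = 2))"

definition minimal_rdf :: "'a set \<Rightarrow> 'a set set \<Rightarrow> ('a \<Rightarrow> nat) \<Rightarrow> bool" where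
  "minimal_rdf V E g \<longleftrightarrow> rdf V E g \<and>
    (\<forall>g'. rdf V E g' \<and> (\<forall>v\<in>V. g' v \<le> g v) \<longrightarrow> (\<forall>v\<in>V. g' v = g v))"

section \<open>Bounded Extension Roman Domination\<close>

text \<open>An instance has vertices \<open>0, \<dots>, n - 1\<close>; \<open>f\<close> and \<open>h\<close> are given by their lists of values.\<close>

record berd_inst =
  order :: nat
  edge_list :: "(nat \<times> nat) list"
  lower :: "nat list"
  upper :: "nat list"

definition wf_inst :: "berd_inst \<Rightarrow> bool" where
  "wf_inst J \<longleftrightarrow>
    (\<forall>(u, v) \<in> set (edge_list J). u < order J \<and> v < order J \<and> u \<noteq> v) \<and>
    length (lower J) = order J \<and> set (lower J) \<subseteq> {0, 1, 2} \<and>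
    length (upper J) = order J \<and> set (upper J) \<subseteq> {0, 1, 2}"

definition verts :: "berd_inst \<Rightarrow> nat set" where
  "verts J = {..<order J}"

definition edges :: "berd_inst \<Rightarrow> nat set set" where
  "edges J = {{u, v} | u v. (u, v) \<in> set (edge_list J)}"

definition enc_inst :: "berd_inst \<Rightarrow> tree" where
  "enc_inst J = Node (num (order J))
    (Node (enc_pairs (edge_list J)) (Node (enc_nats (lower J)) (enc_nats (upper J))))"

definition param :: "berd_inst \<Rightarrow> nat" where
  "param J = card {v \<in> verts J. upper J ! v = 0}"

definition BERD :: problem where
  "BERD = {(enc_inst J, param J) | J. wf_inst J \<and>
    (\<exists>g. minimal_rdf (verts J) (edges J) g \<and>
      (\<forall>v \<in> verts J. lower J ! v \<le> g v \<and> g v \<le> upper J ! v))}"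

definition bipartite_instances :: "(tree \<times> nat) set" where
  "bipartite_instances = {(enc_inst J, param J) | J. wf_inst J \<and> bipartite (verts J) (edges J)}"

end

theory Submission
  imports Defs
begin

text \<open>
  Every problem in W[1] reduces to satisfiability of circuits of weft 1 and bounded depth by
  assignments of weight \<open>k\<close>. Choose such an assignment by \<open>k\<close> picks from the inputs. Both ``input \<open>a\<close>
  is false'' (no pick is \<open>a\<close>) and ``input \<open>a\<close> is true'' (for some \<open>i\<close>, the \<open>i\<close>-th pick is none of
  the other inputs) are disjunctions of conditions of the form ``none of these candidates is picked'',
  and such conditions are closed under conjunction. The part of the circuit below a large gate has
  constant size, hence a disjunctive normal form of polynomial size over these conditions; large gates
  and the constantly many gates above them are then multiplied out to a polynomial-size conjunction of
  such disjunctive normal forms, since only one large gate lies on each path.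

  In a minimal Roman dominating function every vertex of value 2 has a private neighbour of value 0.
  Forcing a vertex to 2 and capping its neighbours at 1 thus expresses one disjunction of conditions,
  and the \<open>k\<close> picks are enforced by \<open>k\<close> vertices with upper bound 0, which have to be dominated.
\<close>

section \<open>Running times\<close>

text \<open>The gadget can only test for absence: a clause vertex keeps the value 2 through a term
  vertex none of whose candidates has value 2. Hence truth and falsity of an input both have to be
  phrased as picks that are not made. As negations may stand anywhere, every node carries forms of
  both polarities, and a negation swaps them. Picks may coincide, so further clauses force them to
  be distinct. Membership in \<open>W 1\<close> supplies one depth bound \<open>d\<close> per
  problem. The reduction is a separate program for each \<open>d\<close>, whose polynomial may
  depend on \<open>d\<close>; sizes of normal forms are never computed, since the closure properties
  of \<open>ptime\<close> yield some polynomial. The given reduction to \<open>WCS 1 d\<close> is an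
  arbitrary program: it may leave values in registers, it may output trees that encode no circuit,
  and its time bound in \<open>k\<close> is merely computable. Composing with it requires clearing
  registers, deciding which trees are codes, and showing that the new time bound is computable
  again.\<close>

definition runs_in :: "prog \<Rightarrow> state \<Rightarrow> state \<Rightarrow> nat \<Rightarrow> bool" where
  "runs_in c s s' T \<longleftrightarrow> (\<exists>t\<le>T. exec c s t s')"

lemma runs_in_Assign: "runs_in (Assign i e) s (s(i := val e s)) (1 + tsize (val e s))"
  unfolding runs_in_def using exec.Assign by blast

lemma runs_in_Seq:
  "runs_in c1 s s1 T1 \<Longrightarrow> runs_in c2 s1 s2 T2 \<Longrightarrow> runs_in (Seq c1 c2) s s2 (T1 + T2)"
  unfolding runs_in_def by (meson exec.Seq add_mono)

lemma runs_in_Cond: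
  assumes "val e s \<noteq> Leaf \<Longrightarrow> runs_in c1 s s' T" "val e s = Leaf \<Longrightarrow> runs_in c2 s s' T"
  shows "runs_in (Cond e c1 c2) s s' (1 + T)"
proof (cases "val e s = Leaf")
  case True
  then obtain t where "t \<le> T" "exec c2 s t s'" using assms unfolding runs_in_def by blast
  then show ?thesis unfolding runs_in_def using exec.CondFalse[OF True] by (intro exI[of _ "1+t"]) auto
next
  case False
  then obtain t where "t \<le> T" "exec c1 s t s'" using assms unfolding runs_in_def by blast
  then show ?thesis unfolding runs_in_def using exec.CondTrue[OF False] by (intro exI[of _ "1+t"]) auto
qed

lemma runs_in_While_stop: "val e s = Leaf \<Longrightarrow> runs_in (While e c) s s 1"
  unfolding runs_in_def using exec.WhileFalse by blast

lemma runs_in_While_step: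
  assumes "val e s \<noteq> Leaf" "runs_in c s s1 T1" "runs_in (While e c) s1 s2 T2"
  shows "runs_in (While e c) s s2 (1 + T1 + T2)"
proof -
  obtain t1 t2 where "t1 \<le> T1" "exec c s t1 s1" "t2 \<le> T2" "exec (While e c) s1 t2 s2"
    using assms unfolding runs_in_def by blast
  then show ?thesis unfolding runs_in_def
    using exec.WhileTrue[OF assms(1)] by (intro exI[of _ "1+t1+t2"]) auto
qed

lemma runs_in_mono: "runs_in c s s' T \<Longrightarrow> T \<le> T' \<Longrightarrow> runs_in c s s' T'"
  unfolding runs_in_def by (meson le_trans)

text \<open>An assignment is charged with the size of the stored value, so a register that has
  changed holds a tree no larger than the total time.\<close>

lemma exec_tsize: "exec c s t s' \<Longrightarrow> s' i = s i \<or> tsize (s' i) \<le> t"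
  by (induction rule: exec.induct) auto

lemma runs_in_tsize: "runs_in c s s' T \<Longrightarrow> tsize (s' i) \<le> tsize (s i) + T"
  unfolding runs_in_def using exec_tsize[of c s _ s' i] by fastforce

lemma tsize_pos: "tsize x \<ge> 1"
  by (cases x) auto

section \<open>Polynomial bounds\<close>

text \<open>The base is at least 2, so constants and constant factors are absorbed into the exponent
  and the single number \<open>c\<close> suffices.\<close>

definition poly :: "(tree \<Rightarrow> nat) \<Rightarrow> bool" where
  "poly T \<longleftrightarrow> (\<exists>c. \<forall>x. T x \<le> (1 + tsize x) ^ c)"

lemma poly_mono: "poly T \<Longrightarrow> (\<And>x. T' x \<le> T x) \<Longrightarrow> poly T'"
  unfolding poly_def by (meson le_trans)

lemma poly_tsize: "poly tsize"
  unfolding poly_def by (rule exI[of _ 1]) simp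

lemma le_two_power: "a \<le> (1 + tsize x) ^ a"
proof -
  have "a \<le> 2 ^ a" using less_exp[of a] by simp
  also have "\<dots> \<le> (1 + tsize x) ^ a" using tsize_pos[of x] by (intro power_mono) auto
  finally show ?thesis .
qed

lemma poly_const: "poly (\<lambda>_. a)"
  unfolding poly_def using le_two_power by blast

lemma poly_mult:
  assumes "poly S" "poly T" shows "poly (\<lambda>x. S x * T x)"
proof -
  obtain c d where "\<And>x. S x \<le> (1 + tsize x) ^ c" "\<And>x. T x \<le> (1 + tsize x) ^ d"
    using assms unfolding poly_def by blast
  then show ?thesis unfolding poly_def
    by (intro exI[of _ "c + d"]) (simp add: power_add mult_mono)
qed

lemma poly_add:
  assumes "poly S" "poly T" shows "poly (\<lambda>x. S x + T x)"
proof -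
  obtain c d where 1: "\<And>x. S x \<le> (1 + tsize x) ^ c" "\<And>x. T x \<le> (1 + tsize x) ^ d"
    using assms unfolding poly_def by blast
  have "S x + T x \<le> (1 + tsize x) ^ (1 + c + d)" for x
  proof -
    let ?b = "1 + tsize x"
    have "S x \<le> ?b ^ (c + d)"
      by (rule le_trans[OF 1(1)]) (intro power_increasing, auto)
    moreover have "T x \<le> ?b ^ (c + d)"
      by (rule le_trans[OF 1(2)]) (intro power_increasing, auto)
    ultimately have "S x + T x \<le> 2 * ?b ^ (c + d)" by simp
    also have "\<dots> \<le> ?b * ?b ^ (c + d)" using tsize_pos[of x] by (intro mult_right_mono) auto
    finally show ?thesis by simp
  qed
  then show ?thesis unfolding poly_def by blast
qed

lemma poly_power: "poly T \<Longrightarrow> poly (\<lambda>x. T x ^ c)"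
  by (induction c) (auto intro: poly_const poly_mult)

lemma poly_Suc: "poly T \<Longrightarrow> poly (\<lambda>x. Suc (T x))"
  using poly_add[OF poly_const[of 1]] by simp

lemmas poly_intros = poly_const poly_tsize poly_mult poly_add poly_power poly_Suc

section \<open>Polynomial-time functions\<close>

definition fclean :: "nat \<Rightarrow> state \<Rightarrow> bool" where
  "fclean m s \<longleftrightarrow> (\<forall>i. 0 < i \<and> i < m \<longrightarrow> s i = Leaf)"

lemma fclean_mono: "fclean m s \<Longrightarrow> m' \<le> m \<Longrightarrow> fclean m' s"
  unfolding fclean_def by auto

lemma fclean_upd: "fclean m s \<Longrightarrow> i = 0 \<or> i \<ge> m \<Longrightarrow> fclean m (s(i := x))"
  unfolding fclean_def by auto

text \<open>Registers \<open>1, \<dots>, m - 1\<close> are work space that is handed over and returned empty, and all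
  registers from \<open>m\<close> on are untouched, so that such programs can be nested.\<close>

definition computes :: "prog \<Rightarrow> nat \<Rightarrow> (tree \<Rightarrow> tree) \<Rightarrow> (tree \<Rightarrow> nat) \<Rightarrow> bool" where
  "computes p m F T \<longleftrightarrow>
    (\<forall>s. fclean m s \<longrightarrow> runs_in p s (s(0 := F (s 0))) (T (s 0)))"

definition ptime :: "(tree \<Rightarrow> tree) \<Rightarrow> bool" where
  "ptime F \<longleftrightarrow> (\<exists>p m c. computes p m F (\<lambda>x. (1 + tsize x) ^ c))"

lemma computes_mono: "computes p m F T \<Longrightarrow> m \<le> m' \<Longrightarrow> computes p m' F T"
  unfolding computes_def using fclean_mono by blast

lemma ptimeI:
  assumes "computes p m F T" "poly T" shows "ptime F"
proof -
  obtain c where "\<And>x. T x \<le> (1 + tsize x) ^ c" using assms(2) unfolding poly_def by blast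
  then have "computes p m F (\<lambda>x. (1 + tsize x) ^ c)"
    using assms(1) runs_in_mono unfolding computes_def by blast
  then show ?thesis unfolding ptime_def by blast
qed

text \<open>Claiming more work space is harmless. The strict bound makes \<open>m\<close> positive,
  so a value saved in register \<open>m\<close> never overwrites the argument in register 0.\<close>

lemma ptimeE:
  assumes "ptime F"
  obtains p m c where "computes p m F (\<lambda>x. (1 + tsize x) ^ c)" "m > m0"
proof -
  obtain p m c where "computes p m F (\<lambda>x. (1 + tsize x) ^ c)"
    using assms unfolding ptime_def by blast
  from computes_mono[OF this, of "m + Suc m0"] show ?thesis by (intro that) auto
qed

text \<open>The result is stored in register 0, so the time bound also limits its size. Composition
  needs this, as the second program is charged in the size of the first result.\<close>

lemma ptime_size:
  assumes "ptime F" shows "poly (\<lambda>x. tsize (F x))"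
proof -
  obtain p m c where p: "computes p m F (\<lambda>x. (1 + tsize x) ^ c)" using assms ptimeE by blast
  have "tsize (F x) \<le> tsize x + (1 + tsize x) ^ c" for x
  proof -
    let ?s = "(\<lambda>_. Leaf)(0 := x)"
    have "runs_in p ?s (?s(0 := F x)) ((1 + tsize x) ^ c)"
      using p[unfolded computes_def, rule_format, of ?s] by (simp add: fclean_def)
    from runs_in_tsize[OF this, of 0] show ?thesis by simp
  qed
  then show ?thesis by (intro poly_mono[OF poly_add[OF poly_tsize poly_power[OF poly_add[OF poly_const poly_tsize]]]])
qed

lemma computes_expr:
  assumes "\<And>s. val e s = F (s 0)"
  shows "computes (Assign 0 e) 1 F (\<lambda>x. 1 + tsize (F x))"
  unfolding computes_def using runs_in_Assign[of 0 e] assms by auto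

lemma ptime_id: "ptime (\<lambda>x. x)"
  by (rule ptimeI[OF computes_expr[of "Var 0"]]) (auto intro!: poly_intros)

lemma ptime_const: "ptime (\<lambda>_. c)"
proof -
  have "\<exists>e. \<forall>s. val e s = c"
  proof (induction c)
    case Leaf
    show ?case by (rule exI[of _ ELeaf]) simp
  next
    case (Node a b)
    then obtain e1 e2 where "\<forall>s. val e1 s = a" "\<forall>s. val e2 s = b" by blast
    then show ?case by (intro exI[of _ "ENode e1 e2"]) simp
  qed
  then obtain e where "\<And>s. val e s = c" by blast
  then show ?thesis by (intro ptimeI[OF computes_expr[of e]]) (auto intro!: poly_intros)
qed

lemma tsize_left: "tsize (left x) \<le> tsize x" by (cases x) auto
lemma tsize_right: "tsize (right x) \<le> tsize x" by (cases x) auto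

lemma ptime_left0: "ptime left"
  by (rule ptimeI[OF computes_expr[of "ELeft (Var 0)"]])
    (auto intro!: poly_mono[OF poly_Suc[OF poly_tsize]] tsize_left)

lemma ptime_right0: "ptime right"
  by (rule ptimeI[OF computes_expr[of "ERight (Var 0)"]])
    (auto intro!: poly_mono[OF poly_Suc[OF poly_tsize]] tsize_right)

lemma ptime_comp:
  assumes "ptime F" "ptime G" shows "ptime (\<lambda>x. F (G x))"
proof -
  obtain p m c where p: "computes p m G (\<lambda>x. (1 + tsize x) ^ c)" using assms(2) ptimeE by blast
  obtain q m' c' where q: "computes q m' F (\<lambda>x. (1 + tsize x) ^ c')" "m' > m" using assms(1) ptimeE by blast
  have "computes (Seq p q) m' (\<lambda>x. F (G x)) (\<lambda>x. (1 + tsize x) ^ c + (1 + tsize (G x)) ^ c')"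
    unfolding computes_def
  proof (intro allI impI)
    fix s assume s: "fclean m' s"
    have 1: "runs_in p s (s(0 := G (s 0))) ((1 + tsize (s 0)) ^ c)"
      using p fclean_mono[OF s, of m] q(2) unfolding computes_def by simp
    let ?s = "s(0 := G (s 0))"
    have 2: "runs_in q ?s (?s(0 := F (?s 0))) ((1 + tsize (?s 0)) ^ c')"
      using q(1) fclean_upd[OF s, of 0] unfolding computes_def by blast
    show "runs_in (Seq p q) s (s(0 := F (G (s 0)))) ((1 + tsize (s 0)) ^ c + (1 + tsize (G (s 0))) ^ c')"
      using runs_in_Seq[OF 1 2] by simp
  qed
  then show ?thesis by (rule ptimeI) (intro poly_intros ptime_size assms)
qed

text \<open>The first program overwrites its argument; registers \<open>m'\<close> and
  \<open>Suc m'\<close> keep the argument and the first result and are emptied at the end.\<close>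

lemma ptime_Node:
  assumes "ptime F" "ptime G" shows "ptime (\<lambda>x. Node (F x) (G x))"
proof -
  obtain p m c where p: "computes p m F (\<lambda>x. (1 + tsize x) ^ c)" using assms(1) ptimeE by blast
  obtain q m' c' where q: "computes q m' G (\<lambda>x. (1 + tsize x) ^ c')" "m' > m" using assms(2) ptimeE by blast
  let ?prog = "Seq (Assign m' (Var 0)) (Seq p (Seq (Assign (Suc m') (Var 0)) (Seq (Assign 0 (Var m'))
     (Seq q (Seq (Assign 0 (ENode (Var (Suc m')) (Var 0))) (Seq (Assign m' ELeaf) (Assign (Suc m') ELeaf)))))))"
  let ?T = "\<lambda>x. (1 + tsize x) + ((1 + tsize x) ^ c + ((1 + tsize (F x)) + ((1 + tsize x) +
     ((1 + tsize x) ^ c' + ((1 + (1 + tsize (F x) + tsize (G x))) + ((1 + 1) + (1 + 1)))))))"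
  have "computes ?prog (Suc (Suc m')) (\<lambda>x. Node (F x) (G x)) ?T"
    unfolding computes_def
  proof (intro allI impI)
    fix s assume s: "fclean (Suc (Suc m')) s"
    let ?x = "s 0"
    define s1 where "s1 = s(m' := ?x)"
    define s2 where "s2 = s1(0 := F ?x)"
    define s3 where "s3 = s2(Suc m' := F ?x)"
    define s4 where "s4 = s3(0 := ?x)"
    define s5 where "s5 = s4(0 := G ?x)"
    define s6 where "s6 = s5(0 := Node (F ?x) (G ?x))"
    define s7 where "s7 = s6(m' := Leaf)"
    define s8 where "s8 = s7(Suc m' := Leaf)"
    note defs = s1_def s2_def s3_def s4_def s5_def s6_def s7_def s8_def
    have s': "fclean m' s1" "fclean m' s4" "s1 0 = ?x" "s4 0 = ?x"
      using s q(2) unfolding defs fclean_def by auto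
    have 1: "runs_in (Assign m' (Var 0)) s s1 (1 + tsize ?x)"
      using runs_in_Assign[of m' "Var 0" s] unfolding s1_def by simp
    have 2: "runs_in p s1 s2 ((1 + tsize ?x) ^ c)"
      using p s'(3) q(2) fclean_mono[OF s'(1), of m] unfolding computes_def s2_def by (metis less_imp_le)
    have 3: "runs_in (Assign (Suc m') (Var 0)) s2 s3 (1 + tsize (F ?x))"
      using runs_in_Assign[of "Suc m'" "Var 0" s2] unfolding s3_def s2_def by simp
    have 4: "runs_in (Assign 0 (Var m')) s3 s4 (1 + tsize ?x)"
      using runs_in_Assign[of 0 "Var m'" s3] q(2) unfolding s4_def s3_def s2_def s1_def by simp
    have 5: "runs_in q s4 s5 ((1 + tsize ?x) ^ c')"
      using q s' unfolding computes_def s5_def by metis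
    have 6: "runs_in (Assign 0 (ENode (Var (Suc m')) (Var 0))) s5 s6 (1 + (1 + tsize (F ?x) + tsize (G ?x)))"
      using runs_in_Assign[of 0 "(ENode (Var (Suc m')) (Var 0))" s5] unfolding s6_def s5_def s4_def s3_def by simp
    have 7: "runs_in (Assign m' ELeaf) s6 s7 (1 + 1)"
      using runs_in_Assign[of m' ELeaf s6] unfolding s7_def by simp
    have 8: "runs_in (Assign (Suc m') ELeaf) s7 s8 (1 + 1)"
      using runs_in_Assign[of "Suc m'" ELeaf s7] unfolding s8_def by simp
    have eq: "s8 = s(0 := Node (F ?x) (G ?x))"
      using s q(2) unfolding defs fclean_def by (auto simp: fun_eq_iff)
    show "runs_in ?prog s (s(0 := Node (F ?x) (G ?x))) (?T ?x)"
      unfolding eq[symmetric] by (intro runs_in_Seq[OF 1] runs_in_Seq[OF 2] runs_in_Seq[OF 3]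
        runs_in_Seq[OF 4] runs_in_Seq[OF 5] runs_in_Seq[OF 6] runs_in_Seq[OF 7] 8)
  qed
  then show ?thesis by (rule ptimeI) (intro poly_intros ptime_size assms)
qed

text \<open>Test value and argument have to share register 0, so they arrive as a pair;
  \<open>ptime_If\<close> builds that pair.\<close>

lemma ptime_If0:
  assumes "ptime F" "ptime G"
  shows "ptime (\<lambda>x. if left x \<noteq> Leaf then F (right x) else G (right x))"
proof -
  obtain p m c where p: "computes p m F (\<lambda>x. (1 + tsize x) ^ c)" using assms(1) ptimeE by blast
  obtain q m' c' where q: "computes q m' G (\<lambda>x. (1 + tsize x) ^ c')" "m' > m" using assms(2) ptimeE by blast
  let ?a = "Assign 0 (ERight (Var 0))"
  let ?prog = "Cond (ELeft (Var 0)) (Seq ?a p) (Seq ?a q)"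
  let ?T = "\<lambda>x. 1 + (1 + tsize x + ((1 + tsize x) ^ c + (1 + tsize x) ^ c'))"
  have "computes ?prog m' (\<lambda>x. if left x \<noteq> Leaf then F (right x) else G (right x)) ?T"
    unfolding computes_def
  proof (intro allI impI)
    fix s assume s: "fclean m' s"
    let ?x = "s 0"
    define s1 where "s1 = s(0 := right ?x)"
    have 1: "runs_in ?a s s1 (1 + tsize ?x)"
      using runs_in_Assign[of 0 "ERight (Var 0)" s] tsize_right[of ?x] runs_in_mono
      unfolding s1_def by fastforce
    have m: "(1 + tsize (right ?x)) ^ c \<le> (1 + tsize ?x) ^ c"
      "(1 + tsize (right ?x)) ^ c' \<le> (1 + tsize ?x) ^ c'"
      using tsize_right[of ?x] by (auto intro!: power_mono)
    have cl: "fclean m' s1" using s unfolding s1_def by (simp add: fclean_upd)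
    have "runs_in p s1 (s1(0 := F (s1 0))) ((1 + tsize (s1 0)) ^ c)"
      using p fclean_mono[OF cl, of m] q(2) unfolding computes_def by simp
    then have 2: "runs_in p s1 (s1(0 := F (s1 0))) ((1 + tsize ?x) ^ c + (1 + tsize ?x) ^ c')"
      by (rule runs_in_mono) (use m in \<open>simp add: s1_def\<close>)
    have "runs_in q s1 (s1(0 := G (s1 0))) ((1 + tsize (s1 0)) ^ c')"
      using q(1) cl unfolding computes_def by simp
    then have 3: "runs_in q s1 (s1(0 := G (s1 0))) ((1 + tsize ?x) ^ c + (1 + tsize ?x) ^ c')"
      by (rule runs_in_mono) (use m in \<open>simp add: s1_def\<close>)
    show "runs_in ?prog s (s(0 := if left ?x \<noteq> Leaf then F (right ?x) else G (right ?x))) (?T ?x)"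
      using runs_in_Seq[OF 1 2] runs_in_Seq[OF 1 3] unfolding s1_def
      by (intro runs_in_Cond) auto
  qed
  then show ?thesis by (rule ptimeI) (intro poly_intros)
qed

lemma ptime_left: "ptime F \<Longrightarrow> ptime (\<lambda>x. left (F x))"
  by (rule ptime_comp[OF ptime_left0])

lemma ptime_right: "ptime F \<Longrightarrow> ptime (\<lambda>x. right (F x))"
  by (rule ptime_comp[OF ptime_right0])

section \<open>Decidable predicates and case distinctions\<close>

definition pdec :: "(tree \<Rightarrow> bool) \<Rightarrow> bool" where
  "pdec P \<longleftrightarrow> ptime (\<lambda>x. if P x then num 1 else Leaf)"

lemma ptime_If: 
  assumes "pdec P" "ptime F" "ptime G" shows "ptime (\<lambda>x. if P x then F x else G x)"
proof -
  have "ptime (\<lambda>x. Node (if P x then num 1 else Leaf) x)"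
    using assms(1) unfolding pdec_def by (intro ptime_Node ptime_id)
  from ptime_comp[OF ptime_If0[OF assms(2,3)] this] show ?thesis
    by (rule back_subst[of ptime]) auto
qed

lemma pdec_Leaf: assumes "ptime F" shows "pdec (\<lambda>x. F x = Leaf)"
  using ptime_comp[OF ptime_If0[OF ptime_const ptime_const] ptime_Node[OF assms ptime_id], of Leaf "num 1"]
  unfolding pdec_def by (rule back_subst[of ptime]) auto

lemma pdec_not: "pdec P \<Longrightarrow> pdec (\<lambda>x. \<not> P x)"
  using ptime_If[OF _ ptime_const ptime_const, of P Leaf "num 1"] unfolding pdec_def[of "\<lambda>x. \<not> P x"]
  by (auto elim!: back_subst[of ptime])

lemma pdec_conj: assumes "pdec P" "pdec Q" shows "pdec (\<lambda>x. P x \<and> Q x)"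
  using ptime_If[OF assms(1) assms(2)[unfolded pdec_def] ptime_const, of Leaf]
  unfolding pdec_def[of "\<lambda>x. P x \<and> Q x"] by (auto elim!: back_subst[of ptime])

lemma pdec_disj: assumes "pdec P" "pdec Q" shows "pdec (\<lambda>x. P x \<or> Q x)"
  using pdec_not[OF pdec_conj[OF pdec_not[OF assms(1)] pdec_not[OF assms(2)]]] by simp

text \<open>Every tree is the code of exactly one list, so all list functions below are total. A
  unary number is a list of \<open>Leaf\<close>s, and any tree \<open>t\<close> can serve as the
  number \<open>len t\<close>.\<close>

primrec lst :: "tree \<Rightarrow> tree list" where
  "lst Leaf = []"
| "lst (Node a b) = a # lst b"

lemma lst_enc_list [simp]: "lst (enc_list xs) = xs"
  by (induction xs) auto

lemma enc_list_lst [simp]: "enc_list (lst t) = t"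
  by (induction t) auto

lemma lst_inject: "lst s = lst t \<longleftrightarrow> s = t"
  by (metis enc_list_lst)

lemma lst_right [simp]: "lst (right t) = tl (lst t)"
  by (cases t) auto

lemma left_lst: "lst t \<noteq> [] \<Longrightarrow> left t = hd (lst t)"
  by (cases t) auto

lemma lst_eq_Nil [simp]: "lst t = [] \<longleftrightarrow> t = Leaf"
  by (cases t) auto

abbreviation len :: "tree \<Rightarrow> nat" where "len t \<equiv> length (lst t)"

lemma tsize_lst: "tsize t = 1 + (\<Sum>e\<leftarrow>lst t. 1 + tsize e)"
  by (induction t) auto

lemma len_le_tsize: "len t \<le> tsize t"
  by (induction t) auto

lemma tsize_elem: "e \<in> set (lst t) \<Longrightarrow> tsize e \<le> tsize t"
  by (induction t) auto

lemma num_eq: "num n = enc_list (replicate n Leaf)"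
  by (induction n) auto

lemma lst_num [simp]: "lst (num n) = replicate n Leaf"
  by (simp add: num_eq)

text \<open>Registers \<open>m\<close>, \<open>m + 1\<close>, \<open>m + 2\<close> hold the
  argument, the accumulator and the remaining list. As long as all accumulators stay within
  \<open>B\<close>, a round costs at most \<open>K\<close>. Register 0 is left with some
  \<open>z\<close>: the last accumulator, or its old content if the list is empty.\<close>

lemma runs_in_loop:
  assumes p: "computes p m (\<lambda>y. G (left y) (left (right y)) (right (right y))) (\<lambda>x. (1 + tsize x) ^ c)"
    and m: "0 < m" and x: "tsize x \<le> B"
    and K: "K = 1 + ((1 + (2 + 3 * B)) + ((3 + 3 * B) ^ c + ((1 + B) + (1 + B))))"
  shows "fclean m s \<Longrightarrow> s m = x \<Longrightarrow> s (m + 1) = a \<Longrightarrow> s (m + 2) = l \<Longrightarrow> tsize l \<le> B \<Longrightarrow>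
    (\<And>es es'. lst l = es @ es' \<Longrightarrow> tsize (foldl (G x) a es) \<le> B) \<Longrightarrow>
    \<exists>z. runs_in (While (Var (m + 2))
        (Seq (Assign 0 (ENode (Var m) (ENode (Var (m + 1)) (ELeft (Var (m + 2))))))
        (Seq p (Seq (Assign (m + 1) (Var 0)) (Assign (m + 2) (ERight (Var (m + 2))))))))
      s (s(0 := z, m + 1 := foldl (G x) a (lst l), m + 2 := Leaf)) (1 + len l * K)"
proof (induction l arbitrary: s a)
  case Leaf
  have "s(0 := s 0, m + 1 := a, m + 2 := Leaf) = s" using Leaf by auto
  then show ?case using runs_in_While_stop[of "Var (m + 2)" s] Leaf
    by (intro exI[of _ "s 0"]) (simp only: lst.simps foldl_Nil list.size mult_0 add_0_right val.simps)
next
  case (Node e l)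
  let ?a0 = "Assign 0 (ENode (Var m) (ENode (Var (m + 1)) (ELeft (Var (m + 2)))))"
  define y where "y = tree.Node x (tree.Node a e)"
  have a: "tsize a \<le> B" using Node.prems(6)[of "[]"] by simp
  have a': "tsize (G x a e) \<le> B" using Node.prems(6)[of "[e]"] by simp
  have y: "tsize y \<le> 2 + 3 * B" using a x Node.prems(5) unfolding y_def by simp
  define s1 where "s1 = s(0 := y)"
  define s2 where "s2 = s1(0 := G x a e)"
  define s3 where "s3 = s2(m + 1 := G x a e)"
  define s4 where "s4 = s3(m + 2 := l)"
  have 1: "runs_in ?a0 s s1 (1 + (2 + 3 * B))"
    using runs_in_Assign[of 0 "ENode (Var m) (ENode (Var (m + 1)) (ELeft (Var (m + 2))))" s] Node.prems y
    unfolding s1_def y_def by (auto elim!: runs_in_mono)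
  have "fclean m s1" unfolding s1_def by (simp add: fclean_upd Node.prems(1))
  then have "runs_in p s1 (s1(0 := G x a e)) ((1 + tsize (s1 0)) ^ c)"
    using p unfolding computes_def by (force simp: s1_def y_def)
  then have "runs_in p s1 s2 ((1 + tsize y) ^ c)"
    unfolding s2_def by (simp add: s1_def)
  then have 2: "runs_in p s1 s2 ((3 + 3 * B) ^ c)"
    by (rule runs_in_mono) (use y in \<open>auto intro!: power_mono\<close>)
  have 3: "runs_in (Assign (m + 1) (Var 0)) s2 s3 (1 + B)"
    using runs_in_Assign[of "m + 1" "Var 0" s2] a' unfolding s3_def s2_def
    by (auto elim!: runs_in_mono)
  have 4: "runs_in (Assign (m + 2) (ERight (Var (m + 2)))) s3 s4 (1 + B)"
    using runs_in_Assign[of "m + 2" "ERight (Var (m + 2))" s3] Node.prems(4,5) m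
    unfolding s4_def s3_def s2_def s1_def by (auto elim!: runs_in_mono)
  have "fclean m s4" using Node.prems(1) unfolding s4_def s3_def s2_def s1_def by (auto simp: fclean_def)
  moreover have "tsize (foldl (G x) (G x a e) es) \<le> B" if "lst l = es @ es'" for es es'
    using Node.prems(6)[of "e # es" es'] that by simp
  ultimately obtain z where 5: "runs_in (While (Var (m + 2))
        (Seq ?a0 (Seq p (Seq (Assign (m + 1) (Var 0)) (Assign (m + 2) (ERight (Var (m + 2))))))))
      s4 (s4(0 := z, m + 1 := foldl (G x) (G x a e) (lst l), m + 2 := Leaf)) (1 + len l * K)"
    using Node.IH(2)[of s4 "G x a e"] Node.prems m unfolding s4_def s3_def s2_def s1_def by fastforce
  have "val (Var (m + 2)) s \<noteq> Leaf" using Node.prems by simp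
  from runs_in_While_step[OF this runs_in_Seq[OF 1 runs_in_Seq[OF 2 runs_in_Seq[OF 3 4]]] 5]
  have "runs_in (While (Var (m + 2))
        (Seq ?a0 (Seq p (Seq (Assign (m + 1) (Var 0)) (Assign (m + 2) (ERight (Var (m + 2))))))))
      s (s4(0 := z, m + 1 := foldl (G x) (G x a e) (lst l), m + 2 := Leaf)) (1 + len (tree.Node e l) * K)"
    by (rule runs_in_mono) (simp add: K)
  moreover have "s4(0 := z, m + 1 := foldl (G x) (G x a e) (lst l), m + 2 := Leaf) =
      s(0 := z, m + 1 := foldl (G x) a (lst (tree.Node e l)), m + 2 := Leaf)"
    using m unfolding s4_def s3_def s2_def s1_def by (auto simp: fun_eq_iff)
  ultimately show ?case by metis
qed

text \<open>A bound on all intermediate accumulators is demanded because a polynomial-time step may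
  double the size, and iterating it would then leave polynomial size.\<close>

lemma ptime_foldl_bounded:
  assumes "ptime (\<lambda>y. G (left y) (left (right y)) (right (right y)))" "ptime I" "ptime L" "poly B"
    and B: "\<And>x es es'. lst (L x) = es @ es' \<Longrightarrow> tsize (foldl (G x) (I x) es) \<le> B x"
  shows "ptime (\<lambda>x. foldl (G x) (I x) (lst (L x)))"
proof -
  have "ptime (\<lambda>x. Node x (Node (I x) (L x)))" by (intro ptime_Node ptime_id assms)
  then obtain q n d where q: "computes q n (\<lambda>x. Node x (Node (I x) (L x))) (\<lambda>x. (1 + tsize x) ^ d)"
    using ptimeE by blast
  obtain p m c where p: "computes p m (\<lambda>y. G (left y) (left (right y)) (right (right y))) (\<lambda>x. (1 + tsize x) ^ c)"
    and mn: "m > n" using assms(1) by (rule ptimeE)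
  let ?w = "While (Var (m + 2))
        (Seq (Assign 0 (ENode (Var m) (ENode (Var (m + 1)) (ELeft (Var (m + 2))))))
        (Seq p (Seq (Assign (m + 1) (Var 0)) (Assign (m + 2) (ERight (Var (m + 2)))))))"
  let ?prog = "Seq q (Seq (Assign m (ELeft (Var 0))) (Seq (Assign (m + 1) (ELeft (ERight (Var 0))))
    (Seq (Assign (m + 2) (ERight (ERight (Var 0)))) (Seq ?w (Seq (Assign 0 (Var (m + 1)))
    (Seq (Assign m ELeaf) (Assign (m + 1) ELeaf)))))))"
  define C where "C x = B x + tsize x + tsize (L x)" for x
  define K where "K x = 1 + ((1 + (2 + 3 * C x)) + ((3 + 3 * C x) ^ c + ((1 + C x) + (1 + C x))))" for x
  let ?T = "\<lambda>x. (1 + tsize x) ^ d + ((1 + C x) + ((1 + C x) + ((1 + C x) + ((1 + C x * K x) +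
    ((1 + C x) + ((1 + 1) + (1 + 1)))))))"
  let ?F = "\<lambda>x. foldl (G x) (I x) (lst (L x))"
  have "computes ?prog (m + 3) ?F ?T"
    unfolding computes_def
  proof (intro allI impI)
    fix s assume s: "fclean (m + 3) s"
    let ?x = "s 0"
    define s1 where "s1 = s(0 := Node ?x (Node (I ?x) (L ?x)))"
    define s2 where "s2 = s1(m := ?x)"
    define s3 where "s3 = s2(m + 1 := I ?x)"
    define s4 where "s4 = s3(m + 2 := L ?x)"
    have Cx: "tsize ?x \<le> C ?x" "tsize (L ?x) \<le> C ?x" by (auto simp: C_def)
    have CB: "lst (L ?x) = es @ es' \<Longrightarrow> tsize (foldl (G ?x) (I ?x) es) \<le> C ?x" for es es'
      using B[of ?x es es'] by (simp add: C_def)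
    have CI: "tsize (I ?x) \<le> C ?x" using CB[of "[]"] by simp
    have CF: "tsize (?F ?x) \<le> C ?x" using CB[of _ "[]"] by simp
    have 1: "runs_in q s s1 ((1 + tsize ?x) ^ d)"
      using q fclean_mono[OF s, of n] mn unfolding computes_def s1_def by simp
    have 2: "runs_in (Assign m (ELeft (Var 0))) s1 s2 (1 + C ?x)"
      using runs_in_Assign[of m "ELeft (Var 0)" s1] Cx mn unfolding s2_def s1_def
      by (auto elim!: runs_in_mono)
    have 3: "runs_in (Assign (m + 1) (ELeft (ERight (Var 0)))) s2 s3 (1 + C ?x)"
      using runs_in_Assign[of "m + 1" "ELeft (ERight (Var 0))" s2] CI mn unfolding s3_def s2_def s1_def
      by (auto elim!: runs_in_mono)
    have 4: "runs_in (Assign (m + 2) (ERight (ERight (Var 0)))) s3 s4 (1 + C ?x)"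
      using runs_in_Assign[of "m + 2" "ERight (ERight (Var 0))" s3] Cx mn unfolding s4_def s3_def s2_def s1_def
      by (auto elim!: runs_in_mono)
    have "fclean m s4" "s4 m = ?x" "s4 (m + 1) = I ?x" "s4 (m + 2) = L ?x"
      using s mn unfolding s4_def s3_def s2_def s1_def by (auto simp: fclean_def)
    then have "\<exists>z. runs_in ?w s4 (s4(0 := z, m + 1 := ?F ?x, m + 2 := Leaf)) (1 + len (L ?x) * K ?x)"
      by (intro runs_in_loop[OF p _ Cx(1) K_def _ _ _ _ Cx(2)] CB) (use mn in auto)
    then obtain z where w: "runs_in ?w s4 (s4(0 := z, m + 1 := ?F ?x, m + 2 := Leaf)) (1 + len (L ?x) * K ?x)"
      by blast
    define s5 where "s5 = s4(0 := z, m + 1 := ?F ?x, m + 2 := Leaf)"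
    define s6 where "s6 = s5(0 := ?F ?x)"
    define s7 where "s7 = s6(m := Leaf)"
    define s8 where "s8 = s7(m + 1 := Leaf)"
    have 5: "runs_in ?w s4 s5 (1 + C ?x * K ?x)"
      unfolding s5_def by (rule runs_in_mono[OF w])
        (use len_le_tsize[of "L ?x"] Cx in \<open>auto intro!: mult_right_mono\<close>)
    have 6: "runs_in (Assign 0 (Var (m + 1))) s5 s6 (1 + C ?x)"
      using runs_in_Assign[of 0 "Var (m + 1)" s5] CF unfolding s6_def s5_def
      by (auto elim!: runs_in_mono)
    have 7: "runs_in (Assign m ELeaf) s6 s7 (1 + 1)"
      using runs_in_Assign[of m ELeaf s6] unfolding s7_def by simp
    have 8: "runs_in (Assign (m + 1) ELeaf) s7 s8 (1 + 1)"
      using runs_in_Assign[of "m + 1" ELeaf s7] unfolding s8_def by simp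
    have eq: "s8 = s(0 := ?F ?x)"
      using s mn unfolding s8_def s7_def s6_def s5_def s4_def s3_def s2_def s1_def fclean_def
      by (auto simp: fun_eq_iff)
    show "runs_in ?prog s (s(0 := ?F ?x)) (?T ?x)"
      unfolding eq[symmetric] by (intro runs_in_Seq[OF 1] runs_in_Seq[OF 2] runs_in_Seq[OF 3]
        runs_in_Seq[OF 4] runs_in_Seq[OF 5] runs_in_Seq[OF 6] runs_in_Seq[OF 7] 8)
  qed
  then show ?thesis
    by (rule ptimeI) (unfold C_def K_def, intro poly_intros ptime_size assms)
qed

text \<open>Growth by at most \<open>B x\<close> per step, independent of the accumulator, adds up
  linearly over the list.\<close>

lemma ptime_foldl_growth:
  assumes G: "ptime (\<lambda>y. G (left y) (left (right y)) (right (right y)))" "ptime I" "ptime L" "poly B"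
    and B: "\<And>x a e. e \<in> set (lst (L x)) \<Longrightarrow> tsize (G x a e) \<le> tsize a + B x"
  shows "ptime (\<lambda>x. foldl (G x) (I x) (lst (L x)))"
proof (rule ptime_foldl_bounded[where B = "\<lambda>x. tsize (I x) + tsize (L x) * B x"])
  fix x es es' assume l: "lst (L x) = es @ es'"
  have "set es \<subseteq> set (lst (L x)) \<Longrightarrow> tsize (foldl (G x) a es) \<le> tsize a + length es * B x" for a
    using B[of _ x]
  proof (induction es arbitrary: a)
    case (Cons e es)
    then show ?case using Cons.IH[of "G x a e"] Cons.prems(2)[of e a] by fastforce
  qed simp
  then have "tsize (foldl (G x) (I x) es) \<le> tsize (I x) + length es * B x" using l by simp
  also have "length es \<le> tsize (L x)" using len_le_tsize[of "L x"] l by simp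
  finally show "tsize (foldl (G x) (I x) es) \<le> tsize (I x) + tsize (L x) * B x" by simp
qed (use assms in \<open>auto intro!: poly_intros ptime_size\<close>)

section \<open>List operations in polynomial time\<close>

definition revapp :: "tree \<Rightarrow> tree \<Rightarrow> tree" where
  "revapp a b = foldl (\<lambda>acc e. Node e acc) b (lst a)"

lemma lst_revapp [simp]: "lst (revapp a b) = rev (lst a) @ lst b"
proof -
  have "lst (foldl (\<lambda>acc e. Node e acc) b es) = rev es @ lst b" for es
    by (induction es arbitrary: b) auto
  then show ?thesis unfolding revapp_def by simp
qed

lemma ptime_revapp: "ptime F \<Longrightarrow> ptime G \<Longrightarrow> ptime (\<lambda>x. revapp (F x) (G x))"
  unfolding revapp_def
  by (rule ptime_foldl_growth[where B = "\<lambda>x. 1 + tsize (F x)"])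
    (intro ptime_Node ptime_left ptime_right ptime_id poly_intros ptime_size | simp add: tsize_elem)+

definition bind :: "tree \<Rightarrow> (tree \<Rightarrow> tree) \<Rightarrow> tree" where
  "bind l f = enc_list (concat (map (\<lambda>e. lst (f e)) (lst l)))"

lemma lst_bind [simp]: "lst (bind l f) = concat (map (\<lambda>e. lst (f e)) (lst l))"
  by (simp add: bind_def)

lemma tsize_revapp: "tsize (revapp a b) + 1 = tsize a + tsize b"
  using tsize_lst[of a] tsize_lst[of b] tsize_lst[of "revapp a b"] by (simp add: rev_map[symmetric])

text \<open>The pieces are pushed in reverse onto an accumulator that is reversed at the end. Each
  piece is polynomial in \<open>x\<close> and \<open>L x\<close>, so the growth is additive.\<close>

lemma ptime_bind:
  assumes f: "ptime (\<lambda>y. f (left y) (right y))" and L: "ptime L"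
  shows "ptime (\<lambda>x. bind (L x) (\<lambda>e. f x e))"
proof -
  obtain c where c: "\<And>y. tsize (f (left y) (right y)) \<le> (1 + tsize y) ^ c"
    using ptime_size[OF f] unfolding poly_def by blast
  have "ptime (\<lambda>x. foldl (\<lambda>acc e. revapp (f x e) acc) Leaf (lst (L x)))"
  proof (rule ptime_foldl_growth[where B = "\<lambda>x. (2 + tsize x + tsize (L x)) ^ c"])
    show "ptime (\<lambda>y. revapp (f (left y) (right (right y))) (left (right y)))"
      using ptime_comp[OF f ptime_Node[OF ptime_left[OF ptime_id] ptime_right[OF ptime_right[OF ptime_id]]]]
      by (intro ptime_revapp ptime_left ptime_right ptime_id) simp
    fix x a e assume "e \<in> set (lst (L x))"
    then have "tsize e \<le> tsize (L x)" by (rule tsize_elem)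
    have "tsize (f x e) \<le> (1 + tsize (Node x e)) ^ c" using c[of "Node x e"] by simp
    also have "\<dots> \<le> (2 + tsize x + tsize (L x)) ^ c"
      using \<open>tsize e \<le> tsize (L x)\<close> by (intro power_mono) auto
    finally show "tsize (revapp (f x e) a) \<le> tsize a + (2 + tsize x + tsize (L x)) ^ c"
      using tsize_revapp[of "f x e" a] by simp
  qed (intro L ptime_const poly_intros ptime_size)+
  then have "ptime (\<lambda>x. revapp (foldl (\<lambda>acc e. revapp (f x e) acc) Leaf (lst (L x))) Leaf)"
    by (intro ptime_revapp ptime_const)
  moreover have "lst (foldl (\<lambda>acc e. revapp (f x e) acc) a es) =
      rev (concat (map (\<lambda>e. lst (f x e)) es)) @ lst a" for x a es
    by (induction es arbitrary: a) auto
  then have "revapp (foldl (\<lambda>acc e. revapp (f x e) acc) Leaf (lst (L x))) Leaf = bind (L x) (\<lambda>e. f x e)" for x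
    by (simp add: lst_inject[symmetric])
  ultimately show ?thesis by simp
qed

definition sing :: "tree \<Rightarrow> tree" where "sing a = Node a Leaf"

lemma lst_sing [simp]: "lst (sing a) = [a]" by (simp add: sing_def)

lemma ptime_sing: "ptime F \<Longrightarrow> ptime (\<lambda>x. sing (F x))"
  unfolding sing_def by (intro ptime_Node ptime_const)

definition mapt :: "tree \<Rightarrow> (tree \<Rightarrow> tree) \<Rightarrow> tree" where
  "mapt l f = bind l (\<lambda>e. sing (f e))"

lemma lst_mapt [simp]: "lst (mapt l f) = map f (lst l)"
  by (simp add: mapt_def)

lemma ptime_mapt:
  "ptime (\<lambda>y. f (left y) (right y)) \<Longrightarrow> ptime L \<Longrightarrow> ptime (\<lambda>x. mapt (L x) (\<lambda>e. f x e))"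
  unfolding mapt_def by (intro ptime_bind ptime_sing)

text \<open>Expressing concatenation as \<open>bind\<close> over a two-element list avoids the
  analysis of another loop.\<close>

definition app :: "tree \<Rightarrow> tree \<Rightarrow> tree" where
  "app a b = bind (Node a (sing b)) (\<lambda>e. e)"

lemma lst_app [simp]: "lst (app a b) = lst a @ lst b"
  by (simp add: app_def)

lemma ptime_app: "ptime F \<Longrightarrow> ptime G \<Longrightarrow> ptime (\<lambda>x. app (F x) (G x))"
  unfolding app_def by (intro ptime_bind[where f = "\<lambda>x e. e"] ptime_right ptime_id ptime_Node ptime_sing)

text \<open>On unary numbers this is truncated subtraction; on lists the same loop drops elements,
  which yields indexing and comparison of lengths.\<close>

definition sub :: "tree \<Rightarrow> tree \<Rightarrow> tree" where
  "sub b a = foldl (\<lambda>acc _. right acc) b (lst a)"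

lemma lst_sub [simp]: "lst (sub b a) = drop (len a) (lst b)"
proof -
  have "lst (foldl (\<lambda>acc _. right acc) b es) = drop (length es) (lst b)" for es :: "tree list"
    by (induction es arbitrary: b) (auto simp: drop_Suc)
  then show ?thesis unfolding sub_def by simp
qed

lemma ptime_sub: "ptime F \<Longrightarrow> ptime G \<Longrightarrow> ptime (\<lambda>x. sub (F x) (G x))"
  unfolding sub_def
  by (rule ptime_foldl_growth[where B = "\<lambda>_. 0"])
    (auto intro!: ptime_left ptime_right ptime_id poly_intros simp: tsize_right)

definition nth_tree :: "tree \<Rightarrow> tree \<Rightarrow> tree" where
  "nth_tree l i = left (sub l i)"

lemma nth_tree: "len i < len l \<Longrightarrow> nth_tree l i = lst l ! len i"
  unfolding nth_tree_def by (subst left_lst) (simp_all add: hd_drop_conv_nth flip: lst_eq_Nil)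

lemma ptime_nth_tree: "ptime F \<Longrightarrow> ptime G \<Longrightarrow> ptime (\<lambda>x. nth_tree (F x) (G x))"
  unfolding nth_tree_def by (intro ptime_left ptime_sub)

definition norm :: "tree \<Rightarrow> tree" where
  "norm l = mapt l (\<lambda>_. Leaf)"

lemma norm_eq: "norm l = num (len l)"
  unfolding norm_def by (simp add: lst_inject[symmetric] map_replicate_const)

lemma ptime_norm: "ptime F \<Longrightarrow> ptime (\<lambda>x. norm (F x))"
  unfolding norm_def by (intro ptime_mapt ptime_const)

definition mul :: "tree \<Rightarrow> tree \<Rightarrow> tree" where
  "mul a b = bind a (\<lambda>_. norm b)"

lemma mul_eq: "mul a b = num (len a * len b)"
proof -
  have "concat (map (\<lambda>e. replicate n Leaf) es) = replicate (length es * n) Leaf" for n and es :: "tree list"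
    by (induction es) (auto simp: replicate_add)
  then show ?thesis unfolding mul_def by (simp add: lst_inject[symmetric] norm_eq)
qed

lemma ptime_mul: "ptime F \<Longrightarrow> ptime G \<Longrightarrow> ptime (\<lambda>x. mul (F x) (G x))"
  unfolding mul_def
  by (intro ptime_bind[where f = "\<lambda>x e. norm (G x)"] ptime_norm)
    (auto intro: ptime_comp[of G left] ptime_left0)

lemma app_num: "app (num a) (num b) = num (a + b)"
  by (simp add: lst_inject[symmetric] replicate_add)

text \<open>The accumulator doubles as the counter: its length is the next index.\<close>

definition enumt :: "tree \<Rightarrow> tree" where
  "enumt l = foldl (\<lambda>acc e. app acc (sing (Node (norm acc) e))) Leaf (lst l)"

lemma lst_enumt_aux:
  "lst (foldl (\<lambda>acc e. app acc (sing (Node (norm acc) e))) Leaf es) =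
    map (\<lambda>(i, e). Node (num i) e) (enumerate 0 es)"
proof (induction es rule: rev_induct)
  case (snoc e es)
  let ?t = "foldl (\<lambda>acc e. app acc (sing (Node (norm acc) e))) Leaf es"
  have "norm ?t = num (length es)" unfolding norm_eq[of ?t] snoc.IH by simp
  then show ?case using snoc.IH by (simp add: enumerate_append_eq)
qed simp

lemma lst_enumt [simp]: "lst (enumt l) = map (\<lambda>(i, e). Node (num i) e) (enumerate 0 (lst l))"
  unfolding enumt_def by (rule lst_enumt_aux)

lemma tsize_num [simp]: "tsize (num n) = 1 + 2 * n"
  by (induction n) auto

text \<open>A step adds the current index, so the growth depends on the accumulator and the additive
  criterion does not apply; a quadratic bound is shown directly.\<close>

lemma ptime_enumt: assumes "ptime F" shows "ptime (\<lambda>x. enumt (F x))"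
  unfolding enumt_def
proof (rule ptime_foldl_bounded[where B = "\<lambda>x. 1 + tsize (F x) * (3 + 3 * tsize (F x))"])
  fix x es es' assume l: "lst (F x) = es @ es'"
  let ?t = "foldl (\<lambda>acc e. app acc (sing (Node (norm acc) e))) Leaf es"
  \<comment> \<open>A list cell, a pair node and \<open>num i\<close> of size
    \<open>1 + 2 * i\<close> together contribute \<open>3 + 2 * i\<close>.\<close>
  have "tsize ?t = 1 + (\<Sum>(i, e) \<leftarrow> enumerate 0 es. 3 + 2 * i + tsize e)"
    by (subst tsize_lst) (simp add: lst_enumt_aux o_def case_prod_unfold numeral_3_eq_3)
  also have "(\<Sum>(i, e) \<leftarrow> enumerate 0 es. 3 + 2 * i + tsize e)
      \<le> (\<Sum>(i, e) \<leftarrow> enumerate 0 es. 3 + 3 * tsize (F x))"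
  proof (rule sum_list_mono, clarify)
    fix i e assume "(i, e) \<in> set (enumerate 0 es)"
    then have "i < length es" "e \<in> set es" by (auto simp: in_set_enumerate_eq)
    then have "i \<le> tsize (F x)" "tsize e \<le> tsize (F x)"
      using l len_le_tsize[of "F x"] tsize_elem[of e "F x"] by auto
    then show "3 + 2 * i + tsize e \<le> 3 + 3 * tsize (F x)" by simp
  qed
  also have "\<dots> = length es * (3 + 3 * tsize (F x))"
    by (simp add: case_prod_unfold sum_list_triv)
  also have "\<dots> \<le> tsize (F x) * (3 + 3 * tsize (F x))"
    using l len_le_tsize[of "F x"] by (intro mult_right_mono) auto
  finally show "tsize ?t \<le> 1 + tsize (F x) * (3 + 3 * tsize (F x))" by simp
qed (intro assms ptime_const ptime_app ptime_sing ptime_Node ptime_norm ptime_left ptime_right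
  ptime_id poly_intros ptime_size)+

definition range_tree :: "tree \<Rightarrow> tree" where
  "range_tree n = mapt (enumt n) left"

lemma lst_range_tree [simp]: "lst (range_tree n) = map num [0..<len n]"
  unfolding range_tree_def
  by (rule nth_equalityI) (auto simp: nth_enumerate_eq)

lemma ptime_range_tree: "ptime F \<Longrightarrow> ptime (\<lambda>x. range_tree (F x))"
  unfolding range_tree_def by (intro ptime_mapt[where f = "\<lambda>x. left"] ptime_enumt ptime_left ptime_right ptime_id)

section \<open>Quantification over lists and comparison of numbers\<close>

lemma pdec_ball:
  assumes "pdec (\<lambda>y. P (left y) (right y))" "ptime L"
  shows "pdec (\<lambda>x. \<forall>e\<in>set (lst (L x)). P x e)"
proof -
  have "pdec (\<lambda>x. bind (L x) (\<lambda>e. if P x e then Leaf else num 1) = Leaf)"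
    using assms by (intro pdec_Leaf ptime_bind ptime_If ptime_const)
  also have "(\<lambda>x. bind (L x) (\<lambda>e. if P x e then Leaf else num 1) = Leaf) = (\<lambda>x. \<forall>e\<in>set (lst (L x)). P x e)"
    by (auto simp flip: lst_eq_Nil split: if_splits)
  finally show ?thesis .
qed

lemma pdec_bex:
  assumes "pdec (\<lambda>y. P (left y) (right y))" "ptime L"
  shows "pdec (\<lambda>x. \<exists>e\<in>set (lst (L x)). P x e)"
  using pdec_not[OF pdec_ball[OF pdec_not[OF assms(1)] assms(2)]] by simp

definition is_unary :: "tree \<Rightarrow> bool" where
  "is_unary t \<longleftrightarrow> (\<forall>e\<in>set (lst t). e = Leaf)"

lemma is_unary: "is_unary t \<longleftrightarrow> t = num (len t)"
proof -
  have "(\<forall>e\<in>set es. e = Leaf) \<longleftrightarrow> es = replicate (length es) Leaf" for es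
    by (induction es) auto
  then show ?thesis unfolding is_unary_def lst_inject[of t, symmetric] lst_num .
qed

lemma pdec_is_unary: "ptime F \<Longrightarrow> pdec (\<lambda>x. is_unary (F x))"
  unfolding is_unary_def by (intro pdec_ball pdec_Leaf ptime_right ptime_id)

lemma pdec_len_less: assumes "ptime F" "ptime G" shows "pdec (\<lambda>x. len (F x) < len (G x))"
proof -
  have "pdec (\<lambda>x. sub (G x) (F x) \<noteq> Leaf)" by (intro pdec_not pdec_Leaf ptime_sub assms)
  then show ?thesis by (simp flip: lst_eq_Nil add: not_le)
qed

lemma pdec_len_eq: assumes "ptime F" "ptime G" shows "pdec (\<lambda>x. len (F x) = len (G x))"
proof -
  have "pdec (\<lambda>x. \<not> len (F x) < len (G x) \<and> \<not> len (G x) < len (F x))"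
    by (intro pdec_conj pdec_not pdec_len_less assms)
  moreover have "(\<lambda>x. \<not> len (F x) < len (G x) \<and> \<not> len (G x) < len (F x)) = (\<lambda>x. len (F x) = len (G x))"
    by auto
  ultimately show ?thesis by simp
qed

section \<open>The graph\<close>

text \<open>
  A pair \<open>(c, S)\<close> of \<open>Q\<close> is a term of clause \<open>c\<close>, satisfied if no vertex of \<open>S\<close> is picked. The
  vertices are, in this order: the candidates \<open>i * n + a\<close> (``the \<open>i\<close>-th pick is \<open>a\<close>'') for \<open>i < k\<close>,
  \<open>a < n\<close>; one vertex per \<open>i\<close> with upper bound 0, which therefore needs a candidate of value 2; one
  vertex per clause, forced to 2; and one vertex per term, bounded by 1. A clause vertex needs a
  term vertex as private neighbour, that is, a term none of whose candidates is picked.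
\<close>

definition gadget :: "nat \<Rightarrow> nat \<Rightarrow> nat \<Rightarrow> (nat \<times> nat list) list \<Rightarrow> berd_inst" where
  "gadget n k m Q = \<lparr>order = k * n + k + m + length Q,
    edge_list = concat (map (\<lambda>i. map (\<lambda>a. (i * n + a, k * n + i)) [0..<n]) [0..<k]) @
      concat (map (\<lambda>(l, c, S). (k * n + k + m + l, k * n + k + c) # map (\<lambda>v. (k * n + k + m + l, v)) S)
        (enumerate 0 Q)),
    lower = replicate (k * n + k) 0 @ replicate m 2 @ replicate (length Q) 0,
    upper = replicate (k * n) 2 @ replicate k 0 @ replicate m 2 @ replicate (length Q) 1\<rparr>"

lemma index_less: "i < k \<Longrightarrow> a < n \<Longrightarrow> i * n + a < k * (n::nat)"
proof -
  assume "i < k" "a < n"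
  then have "i * n + a < Suc i * n" by simp
  also have "\<dots> \<le> k * n" using \<open>i < k\<close> by (intro mult_right_mono) auto
  finally show ?thesis .
qed

text \<open>Division with remainder by \<open>n\<close> recovers the pick and the chosen input from
  the number of a candidate.\<close>

lemma index_inj: "a < n \<Longrightarrow> b < n \<Longrightarrow> i * n + a = j * n + b \<longleftrightarrow> i = j \<and> a = (b::nat)"
  by (metis div_mult_self3 div_less add.right_neutral add_diff_cancel_left' not_less0)

section \<open>Structure and correctness of the gadget graph\<close>

context
  fixes n k m :: nat and Q :: "(nat \<times> nat list) list"
  assumes Q: "\<And>c S. (c, S) \<in> set Q \<Longrightarrow> c < m \<and> (\<forall>v\<in>set S. v < k * n)"
begin

private abbreviation "J \<equiv> gadget n k m Q"
private abbreviation "cv c \<equiv> k * n + k + c"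
private abbreviation "pv l \<equiv> k * n + k + m + l"

definition arc :: "nat \<Rightarrow> nat \<Rightarrow> bool" where
  "arc u v \<longleftrightarrow> (\<exists>i<k. \<exists>a<n. u = i * n + a \<and> v = k * n + i) \<or>
    (\<exists>l<length Q. u = pv l \<and> (v = cv (fst (Q ! l)) \<or> v \<in> set (snd (Q ! l))))"

lemma edge_list_gadget: "(u, v) \<in> set (edge_list J) \<longleftrightarrow> arc u v"
proof -
  have 1: "(u, v) \<in> set (concat (map (\<lambda>i. map (\<lambda>a. (i * n + a, k * n + i)) [0..<n]) [0..<k]))
    \<longleftrightarrow> (\<exists>i<k. \<exists>a<n. u = i * n + a \<and> v = k * n + i)" by fastforce
  have "(u, v) \<in> set (concat (map (\<lambda>(l, c, S). (pv l, cv c) # map (\<lambda>v. (pv l, v)) S) (enumerate 0 Q)))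
    \<longleftrightarrow> (\<exists>x\<in>set (enumerate 0 Q). u = pv (fst x) \<and> (v = cv (fst (snd x)) \<or> v \<in> set (snd (snd x))))"
    by (auto simp: case_prod_unfold)
  also have "\<dots> \<longleftrightarrow> (\<exists>l<length Q. u = pv l \<and> (v = cv (fst (Q ! l)) \<or> v \<in> set (snd (Q ! l))))"
    by (auto simp: in_set_enumerate_eq Bex_def)
  finally show ?thesis using 1 unfolding gadget_def arc_def by (simp add: Un_def)
qed

lemma Q_nth: "l < length Q \<Longrightarrow> fst (Q ! l) < m" "l < length Q \<Longrightarrow> v \<in> set (snd (Q ! l)) \<Longrightarrow> v < k * n"
  using Q[of "fst (Q ! l)" "snd (Q ! l)"] by auto

lemma edges_gadget: "{u, v} \<in> edges J \<longleftrightarrow> arc u v \<or> arc v u"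
  unfolding edges_def edge_list_gadget by (auto simp: doubleton_eq_iff)

lemma arcE:
  assumes "arc u v"
  obtains i a where "i < k" "a < n" "u = i * n + a" "v = k * n + i" "u < k * n"
    | l where "l < length Q" "u = pv l" "v = cv (fst (Q ! l))" "fst (Q ! l) < m"
    | l where "l < length Q" "u = pv l" "v \<in> set (snd (Q ! l))" "v < k * n"
  using assms Q_nth index_less unfolding arc_def by metis

text \<open>The four kinds of vertices occupy consecutive intervals, so comparing numbers rules out
  arcs of all other kinds.\<close>

lemma nb_w:
  assumes "i < k" shows "{k * n + i, u} \<in> edges J \<longleftrightarrow> (\<exists>a<n. u = i * n + a)"
proof
  assume "{k * n + i, u} \<in> edges J"
  then consider "arc (k * n + i) u" | "arc u (k * n + i)" unfolding edges_gadget by blast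
  then show "\<exists>a<n. u = i * n + a"
    by cases (use assms in \<open>auto elim!: arcE\<close>)
qed (unfold edges_gadget arc_def, use assms in blast)

lemma nb_p:
  assumes "l < length Q"
  shows "{pv l, u} \<in> edges J \<longleftrightarrow> u = cv (fst (Q ! l)) \<or> u \<in> set (snd (Q ! l))"
proof
  assume "{pv l, u} \<in> edges J"
  then consider "arc (pv l) u" | "arc u (pv l)" unfolding edges_gadget by blast
  then show "u = cv (fst (Q ! l)) \<or> u \<in> set (snd (Q ! l))"
    by cases (auto elim!: arcE)
qed (unfold edges_gadget arc_def, use assms in blast)

lemma nb_c:
  assumes "c < m" "{cv c, u} \<in> edges J" shows "\<exists>l<length Q. u = pv l \<and> c = fst (Q ! l)"
proof -
  from assms(2) consider "arc (cv c) u" | "arc u (cv c)" unfolding edges_gadget by blast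
  then show ?thesis by cases (use assms(1) in \<open>auto elim!: arcE\<close>)
qed

lemma nb_v:
  assumes "v < k * n" "{v, u} \<in> edges J"
  shows "(\<exists>i<k. u = k * n + i) \<or> (\<exists>l<length Q. u = pv l)"
proof -
  from assms(2) consider "arc v u" | "arc u v" unfolding edges_gadget by blast
  then show ?thesis by cases (use assms(1) in \<open>auto elim!: arcE\<close>)
qed

lemma verts_gadget: "verts J = {..<k * n + k + m + length Q}"
  by (simp add: verts_def gadget_def)

lemma vertex_cases:
  assumes "v \<in> verts J"
  obtains "v < k * n" | i where "i < k" "v = k * n + i" | c where "c < m" "v = cv c"
    | l where "l < length Q" "v = pv l"
proof -
  have v: "v < k * n + k + m + length Q" using assms unfolding verts_gadget by simp
  consider "v < k * n" | "k * n \<le> v" "v < k * n + k" | "k * n + k \<le> v" "v < k * n + k + m"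
    | "k * n + k + m \<le> v" by linarith
  then show thesis
  proof cases
    case 1
    then show ?thesis by (rule that(1))
  next
    case 2
    then show ?thesis by (intro that(2)[of "v - k * n"]) auto
  next
    case 3
    then show ?thesis by (intro that(3)[of "v - (k * n + k)"]) auto
  next
    case 4
    then show ?thesis using v by (intro that(4)[of "v - (k * n + k + m)"]) auto
  qed
qed

lemma wf_gadget: "wf_inst J"
proof -
  have "u < order J \<and> v < order J \<and> u \<noteq> v" if "arc u v" for u v
    using that unfolding gadget_def by (auto elim!: arcE)
  then have "\<forall>(u, v)\<in>set (edge_list J). u < order J \<and> v < order J \<and> u \<noteq> v"
    using edge_list_gadget by fast
  moreover have "length (lower J) = order J \<and> set (lower J) \<subseteq> {0, 1, 2} \<and>
    length (upper J) = order J \<and> set (upper J) \<subseteq> {0, 1, 2}"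
    by (auto simp: gadget_def)
  ultimately show ?thesis unfolding wf_inst_def by blast
qed

text \<open>Candidates and clause vertices form one side, the vertices with upper bound 0 and the
  term vertices the other.\<close>

lemma bipartite_gadget: "bipartite (verts J) (edges J)"
proof -
  define A where "A = {..<k * n} \<union> {k * n + k..<k * n + k + m}"
  define B where "B = {k * n..<k * n + k} \<union> {k * n + k + m..<k * n + k + m + length Q}"
  have "\<exists>a\<in>A. \<exists>b\<in>B. {u, v} = {a, b}" if "arc u v" for u v
  proof -
    have "u \<in> A \<and> v \<in> B \<or> v \<in> A \<and> u \<in> B"
      using that unfolding A_def B_def by (auto elim!: arcE)
    moreover have "{u, v} = {v, u}" by blast
    ultimately show ?thesis by blast
  qed
  then have "\<forall>e\<in>edges J. \<exists>a\<in>A. \<exists>b\<in>B. e = {a, b}"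
    unfolding edges_def edge_list_gadget by blast
  moreover have "A \<union> B = verts J" "A \<inter> B = {}" unfolding verts_gadget A_def B_def by auto
  ultimately show ?thesis unfolding bipartite_def by blast
qed

lemma lower_gadget: "v \<in> verts J \<Longrightarrow> lower J ! v = (if k * n + k \<le> v \<and> v < k * n + k + m then 2 else 0)"
  unfolding verts_gadget by (auto simp: gadget_def nth_append)

lemma upper_gadget: "v \<in> verts J \<Longrightarrow> upper J ! v =
    (if v < k * n then 2 else if v < k * n + k then 0 else if v < k * n + k + m then 2 else 1)"
  unfolding verts_gadget by (auto simp: gadget_def nth_append)

text \<open>Term vertices are bounded by 1 rather than 0, so only the \<open>k\<close> vertices
  enforcing the picks are counted.\<close>

lemma param_gadget: "param J = k"
proof -
  have "{v \<in> verts J. upper J ! v = 0} = {k * n..<k * n + k}"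
    using upper_gadget unfolding verts_gadget by (auto split: if_splits)
  then show ?thesis unfolding param_def by simp
qed

text \<open>Picked candidates and clause vertices get 2, other candidates 1, the rest 0. A candidate
  of value 1 cannot drop to 0, because all its neighbours have value 0; each vertex of value 2 is
  the only dominator of some vertex of value 0.\<close>

lemma gadget_complete:
  assumes \<sigma>: "\<And>i. i < k \<Longrightarrow> \<sigma> i < n"
    and cl: "\<And>c. c < m \<Longrightarrow> \<exists>(c', S)\<in>set Q. c' = c \<and> (\<forall>i<k. i * n + \<sigma> i \<notin> set S)"
  shows "\<exists>g. minimal_rdf (verts J) (edges J) g \<and>
      (\<forall>v\<in>verts J. lower J ! v \<le> g v \<and> g v \<le> upper J ! v)"
proof -
  define g :: "nat \<Rightarrow> nat" where "g v = (if v < k * n then if \<exists>i<k. v = i * n + \<sigma> i then 2 else 1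
    else if k * n + k \<le> v \<and> v < k * n + k + m then 2 else 0)" for v
  have gp: "g (i * n + \<sigma> i) = 2" if "i < k" for i
    using that index_less[OF that \<sigma>[OF that]] unfolding g_def by auto
  have gw: "g (k * n + i) = 0" if "i < k" for i using that unfolding g_def by simp
  have gc: "g (cv c) = 2" if "c < m" for c using that unfolding g_def by simp
  have gl: "g (pv l) = 0" for l unfolding g_def by simp
  have pV: "i * n + \<sigma> i \<in> verts J" if "i < k" for i
    using index_less[OF that \<sigma>[OF that]] unfolding verts_gadget by simp
  have cV: "cv c \<in> verts J" if "c < m" for c using that unfolding verts_gadget by simp
  have wV: "k * n + i \<in> verts J" if "i < k" for i using that unfolding verts_gadget by simp
  have lV: "pv l \<in> verts J" if "l < length Q" for l using that unfolding verts_gadget by simp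
  have rdf: "rdf (verts J) (edges J) g"
    unfolding rdf_def
  proof (intro conjI ballI impI)
    show "g ` verts J \<subseteq> {0, 1, 2}" unfolding g_def by auto
    fix v assume v: "v \<in> verts J" "g v = 0"
    from v(1) show "\<exists>u\<in>verts J. {v, u} \<in> edges J \<and> g u = 2"
    proof (cases rule: vertex_cases)
      case 1
      then show ?thesis using v(2) unfolding g_def by (auto split: if_splits)
    next
      case (2 i)
      then show ?thesis using nb_w[of i] gp pV \<sigma> by blast
    next
      case (3 c)
      then show ?thesis using v(2) gc by simp
    next
      case (4 l)
      then show ?thesis using nb_p[of l] gc cV Q_nth(1) by blast
    qed
  qed
  have "g' v = g v" if g': "rdf (verts J) (edges J) g'" and le: "\<forall>v\<in>verts J. g' v \<le> g v"
    and v: "v \<in> verts J" for g' v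
  proof -
    have dom: "\<exists>u\<in>verts J. {x, u} \<in> edges J \<and> g' u = 2" if "x \<in> verts J" "g' x = 0" for x
      using g' that unfolding rdf_def by blast
    have two: "g u = 2" if "u \<in> verts J" "g' u = 2" for u
    proof -
      have "2 \<le> g u" using le that by (metis (no_types))
      moreover have "g u \<le> 2" unfolding g_def by simp
      ultimately show ?thesis by simp
    qed
    have zero: "g' u = 0" if "u \<in> verts J" "g u = 0" for u using le that by (metis le_zero_eq)
    from v show ?thesis
    proof (cases rule: vertex_cases)
      case 1
      show ?thesis
      proof (cases "\<exists>i<k. v = i * n + \<sigma> i")
        case True
        then obtain i where i: "i < k" "v = i * n + \<sigma> i" by blast
        \<comment> \<open>The vertex enforcing pick \<open>i\<close> has value 0 under
          \<open>g'\<close> as well, so \<open>g'\<close> keeps some candidate of block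
          \<open>i\<close> at 2, and only the picked one can be it.\<close>
        from dom[OF wV zero[OF wV gw], OF i(1) i(1) i(1)]
        obtain u where u: "u \<in> verts J" "{k * n + i, u} \<in> edges J" "g' u = 2" by blast
        then obtain a where "a < n" "u = i * n + a" using nb_w[OF i(1)] by blast
        then have a: "a < n" "i * n + a \<in> verts J" "g' (i * n + a) = 2" using u by auto
        have "i * n + a < k * n" using i a index_less by blast
        then obtain j where "j < k" "i * n + a = j * n + \<sigma> j"
          using two[OF a(2,3)] unfolding g_def by (auto split: if_splits)
        then have "a = \<sigma> i" using index_inj a(1) \<sigma> by metis
        then show ?thesis using a two v i gp by simp
      next
        case False
        then have "g v = 1" using 1 unfolding g_def by auto
        moreover have "g' v \<noteq> 0"
        proof
          assume "g' v = 0"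
          then obtain u where u: "u \<in> verts J" "{v, u} \<in> edges J" "g' u = 2" using dom v by blast
          from nb_v[OF 1 u(2)] two[OF u(1,3)] gw gl show False by auto
        qed
        ultimately show ?thesis using le v by (metis le_antisym less_one not_less)
      qed
    next
      case (2 i)
      then show ?thesis using gw zero v by simp
    next
      case (3 c)
      from cl[OF 3(1)] obtain l where l: "l < length Q" "fst (Q ! l) = c"
        "\<forall>i<k. i * n + \<sigma> i \<notin> set (snd (Q ! l))"
        by (auto simp: in_set_conv_nth)
      \<comment> \<open>This term vertex stays at 0 and needs a dominator; its candidates have value
        1 under \<open>g\<close>, which leaves the clause vertex.\<close>
      from dom[OF lV zero[OF lV gl], OF l(1) l(1)] obtain u where
        u: "u \<in> verts J" "{pv l, u} \<in> edges J" "g' u = 2" by blast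
      from u(2) nb_p[OF l(1)] consider "u = cv c" | "u \<in> set (snd (Q ! l))" using l(2) by blast
      then show ?thesis
      proof cases
        case 1
        then show ?thesis using u 3 gc by simp
      next
        case 2
        then have "g u \<noteq> 2" using Q_nth(2)[OF l(1) 2] l(3) unfolding g_def by auto
        then show ?thesis using two u by blast
      qed
    next
      case (4 l)
      then show ?thesis using gl zero v by simp
    qed
  qed
  then have "minimal_rdf (verts J) (edges J) g" unfolding minimal_rdf_def using rdf by blast
  moreover have "lower J ! v \<le> g v \<and> g v \<le> upper J ! v" if "v \<in> verts J" for v
    using that unfolding lower_gadget[OF that] upper_gadget[OF that] g_def by auto
  ultimately show ?thesis by blast
qed

text \<open>If every term of clause \<open>c\<close> contained a pick, all neighbours of the clause
  vertex would have another neighbour of value 2, and its own value could be lowered, against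
  minimality.\<close>

lemma gadget_sound:
  assumes g: "minimal_rdf (verts J) (edges J) g"
    and bounds: "\<And>v. v \<in> verts J \<Longrightarrow> lower J ! v \<le> g v \<and> g v \<le> upper J ! v"
  shows "\<exists>\<sigma>. (\<forall>i<k. \<sigma> i < n) \<and>
    (\<forall>c<m. \<exists>(c', S)\<in>set Q. c' = c \<and> (\<forall>i<k. i * n + \<sigma> i \<notin> set S))"
proof -
  have rdf: "rdf (verts J) (edges J) g" using g unfolding minimal_rdf_def by blast
  have "\<exists>a<n. g (i * n + a) = 2" if i: "i < k" for i
  proof -
    have w: "k * n + i \<in> verts J" using that unfolding verts_gadget by simp
    have "g (k * n + i) = 0" using bounds[OF w] upper_gadget[OF w] that by simp
    then obtain u where u: "{k * n + i, u} \<in> edges J" "g u = 2" using rdf w unfolding rdf_def by blast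
    then obtain a where "a < n" "u = i * n + a" using nb_w[OF i] by blast
    then show ?thesis using u by auto
  qed
  then obtain \<sigma> where \<sigma>: "\<And>i. i < k \<Longrightarrow> \<sigma> i < n" "\<And>i. i < k \<Longrightarrow> g (i * n + \<sigma> i) = 2" by metis
  have "\<exists>(c', S)\<in>set Q. c' = c \<and> (\<forall>i<k. i * n + \<sigma> i \<notin> set S)" if c: "c < m" for c
  proof (rule ccontr)
    assume neg: "\<not> ?thesis"
    have cV: "cv c \<in> verts J" using c unfolding verts_gadget by simp
    have gc: "g (cv c) = 2" using bounds[OF cV] lower_gadget[OF cV] upper_gadget[OF cV] c by simp
    \<comment> \<open>With 1 instead of 0 the clause vertex itself needs no dominator.\<close>
    let ?g = "g(cv c := 1)"
    have "rdf (verts J) (edges J) ?g"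
      unfolding rdf_def
    proof (intro conjI ballI impI)
      show "?g ` verts J \<subseteq> {0, 1, 2}" using rdf unfolding rdf_def by auto
      fix v assume v: "v \<in> verts J" "?g v = 0"
      then have v0: "g v = 0" by (auto split: if_splits)
      then obtain u where u: "u \<in> verts J" "{v, u} \<in> edges J" "g u = 2"
        using rdf v unfolding rdf_def by blast
      show "\<exists>u\<in>verts J. {v, u} \<in> edges J \<and> ?g u = 2"
      proof (cases "u = cv c")
        case False
        then show ?thesis using u by auto
      next
        case True
        with u nb_c[OF c, of v] obtain l where l: "l < length Q" "v = pv l" "c = fst (Q ! l)"
          by (auto simp: insert_commute)
        have "Q ! l \<in> set Q" using l by simp
        then obtain i where i: "i < k" "i * n + \<sigma> i \<in> set (snd (Q ! l))"
          using neg l(3) unfolding case_prod_unfold by blast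
        have "i * n + \<sigma> i < k * n" using i \<sigma> index_less by blast
        then have "i * n + \<sigma> i \<in> verts J" "i * n + \<sigma> i \<noteq> cv c" unfolding verts_gadget by auto
        then show ?thesis using nb_p[OF l(1)] i \<sigma>(2) l(2) by auto
      qed
    qed
    moreover have "\<forall>v\<in>verts J. ?g v \<le> g v" using gc by simp
    ultimately have "\<forall>v\<in>verts J. ?g v = g v" using g unfolding minimal_rdf_def by blast
    then show False using cV gc by auto
  qed
  then show ?thesis using \<sigma> by blast
qed

end

section \<open>Attributes of circuit nodes\<close>

lemma foldl_snoc_length: "length (foldl (\<lambda>vs g. vs @ [\<phi> vs g]) vs gs) = length vs + length gs"
  by (induction gs arbitrary: vs) auto

lemma foldl_snoc_prefix:
  "i < length vs \<Longrightarrow> foldl (\<lambda>vs g. vs @ [\<phi> vs g]) vs gs ! i = vs ! i"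
  by (induction gs arbitrary: vs) (auto simp: nth_append)

lemma foldl_snoc_take:
  "take (length vs) (foldl (\<lambda>vs g. vs @ [\<phi> vs g]) vs gs) = vs"
  by (rule nth_equalityI) (auto simp: foldl_snoc_length foldl_snoc_prefix)

text \<open>A step sees only the list built so far, which remains a prefix of the final list; hence
  the final list satisfies the recursion of the attribute.\<close>

lemma foldl_snoc_nth:
  assumes "j < length gs"
  shows "foldl (\<lambda>vs g. vs @ [\<phi> vs g]) vs gs ! (length vs + j) =
    \<phi> (take (length vs + j) (foldl (\<lambda>vs g. vs @ [\<phi> vs g]) vs gs)) (gs ! j)"
proof -
  define us where "us = foldl (\<lambda>vs g. vs @ [\<phi> vs g]) vs (take j gs)"
  have us: "length us = length vs + j" using assms by (simp add: us_def foldl_snoc_length)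
  have "foldl (\<lambda>vs g. vs @ [\<phi> vs g]) vs (take j gs @ gs ! j # drop (Suc j) gs) =
      foldl (\<lambda>vs g. vs @ [\<phi> vs g]) (us @ [\<phi> us (gs ! j)]) (drop (Suc j) gs)"
    by (simp add: us_def)
  then have eq: "foldl (\<lambda>vs g. vs @ [\<phi> vs g]) vs gs =
      foldl (\<lambda>vs g. vs @ [\<phi> vs g]) (us @ [\<phi> us (gs ! j)]) (drop (Suc j) gs)"
    by (simp only: id_take_nth_drop[OF assms, symmetric])
  have "take (length us) (foldl (\<lambda>vs g. vs @ [\<phi> vs g]) vs gs) = us"
    using arg_cong[OF foldl_snoc_take[of "us @ [\<phi> us (gs ! j)]" \<phi> "drop (Suc j) gs"], of "take (length us)"]
    unfolding eq by (simp add: min_def)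
  then show ?thesis unfolding us[symmetric] unfolding eq
    using foldl_snoc_prefix[of "length us" "us @ [\<phi> us (gs ! j)]" \<phi> "drop (Suc j) gs"] by simp
qed

lemma length_node_attrs: "length (node_attrs \<phi> a C) = inputs C + length (gates C)"
  by (simp add: node_attrs_def foldl_snoc_length)

lemma node_attrs_input: "i < inputs C \<Longrightarrow> node_attrs \<phi> a C ! i = a i"
  by (simp add: node_attrs_def foldl_snoc_prefix)

lemma node_attrs_gate:
  assumes "j < length (gates C)"
  shows "node_attrs \<phi> a C ! (inputs C + j) = \<phi> (take (inputs C + j) (node_attrs \<phi> a C)) (gates C ! j)"
  using foldl_snoc_nth[OF assms, of \<phi> "map a [0..<inputs C]"] by (simp add: node_attrs_def)

lemma last_node_attrs:
  assumes "inputs C + length (gates C) > 0"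
  shows "last (node_attrs \<phi> a C) = node_attrs \<phi> a C ! (inputs C + length (gates C) - 1)"
proof -
  have "length (node_attrs \<phi> a C) \<noteq> 0" using assms unfolding length_node_attrs by simp
  then have "node_attrs \<phi> a C \<noteq> []" by auto
  then show ?thesis by (simp add: last_conv_nth length_node_attrs)
qed

definition node_val :: "nat set \<Rightarrow> circuit \<Rightarrow> nat \<Rightarrow> bool" where
  "node_val A C i = node_attrs gate_val (\<lambda>i. i \<in> A) C ! i"

definition node_path :: "(gate \<Rightarrow> nat) \<Rightarrow> circuit \<Rightarrow> nat \<Rightarrow> nat" where
  "node_path w C i =
    node_attrs (\<lambda>vs g. w g + Max ((\<lambda>i. vs ! i) ` set (fan_in g))) (\<lambda>_. 0) C ! i"

lemma node_path_gate:
  assumes "wf_circuit C" "j < length (gates C)"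
  shows "node_path w C (inputs C + j) =
    w (gates C ! j) + Max (node_path w C ` set (fan_in (gates C ! j)))"
proof -
  have "i \<in> set (fan_in (gates C ! j)) \<Longrightarrow> i < inputs C + j" for i
    using assms unfolding wf_circuit_def by blast
  then show ?thesis unfolding node_path_def node_attrs_gate[OF assms(2)]
    by (intro arg_cong2[of _ _ _ _ "(+)"] arg_cong[of _ _ Max] image_cong) auto
qed

text \<open>In contrast to \<open>gate_val\<close>, a total valuation is read instead of a list
  prefix that differs from gate to gate.\<close>

primrec gate_sem :: "(nat \<Rightarrow> bool) \<Rightarrow> gate \<Rightarrow> bool" where
  "gate_sem b (GNot i) = (\<not> b i)"
| "gate_sem b (GAnd is) = (\<forall>i\<in>set is. b i)"
| "gate_sem b (GOr is) = (\<exists>i\<in>set is. b i)"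

lemma node_val_gate:
  assumes "wf_circuit C" "j < length (gates C)"
  shows "node_val A C (inputs C + j) = gate_sem (node_val A C) (gates C ! j)"
proof -
  have "i \<in> set (fan_in (gates C ! j)) \<Longrightarrow> i < inputs C + j" for i
    using assms unfolding wf_circuit_def by blast
  then show ?thesis unfolding node_val_def node_attrs_gate[OF assms(2)]
    by (cases "gates C ! j") auto
qed

section \<open>Normal forms\<close>

text \<open>
  A node without large gate below is described by \<open>Node Leaf (Node D D')\<close>, where \<open>D\<close> and \<open>D'\<close> are
  disjunctive normal forms of the node and of its negation: lists of terms, a term being the list of
  candidates that must not be picked. Otherwise it is \<open>Node (num 1) (Node C C')\<close> with lists \<open>C\<close> and
  \<open>C'\<close> of disjunctive normal forms, read as conjunctions. \<open>Leaf\<close> marks nodes of too large weft or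
  depth. On both levels \<open>app\<close> and \<open>cross\<close> implement the two connectives, with opposite roles.
\<close>

definition cross :: "tree \<Rightarrow> tree \<Rightarrow> tree" where
  "cross X Y = bind X (\<lambda>a. mapt Y (\<lambda>b. app a b))"

definition pos :: "tree \<Rightarrow> tree" where "pos a = left (right a)"
definition neg :: "tree \<Rightarrow> tree" where "neg a = right (right a)"

definition negate :: "tree \<Rightarrow> tree" where
  "negate a = (if a = Leaf then Leaf else Node (left a) (Node (neg a) (pos a)))"

definition upgrade :: "tree \<Rightarrow> tree" where
  "upgrade a = (if left a = Leaf then Node (num 1) (Node (sing (pos a)) (sing (neg a))) else a)"

definition and2 :: "tree \<Rightarrow> tree \<Rightarrow> tree" where
  "and2 a b = (if left a = Leaf \<and> left b = Leaf
    then Node Leaf (Node (cross (pos a) (pos b)) (app (neg a) (neg b)))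
    else Node (num 1) (Node (app (pos (upgrade a)) (pos (upgrade b)))
      (cross (neg (upgrade a)) (neg (upgrade b)))))"

text \<open>\<open>Leaf\<close> is tested first, since \<open>left Leaf = Leaf\<close> would make an
  error look like weft 0. Fan-in at most 2 does not add to the weft and is multiplied out; a single
  input is conjoined with itself. For a large gate the negation is one disjunctive normal form, the
  union of those of the negated inputs.\<close>

definition conj_forms :: "tree \<Rightarrow> tree" where
  "conj_forms fs =
    (if \<exists>a\<in>set (lst fs). a = Leaf then Leaf
     else if right (right fs) = Leaf then and2 (left fs) (left (if right fs = Leaf then fs else right fs))
     else if \<exists>a\<in>set (lst fs). left a \<noteq> Leaf then Leaf
     else Node (num 1) (Node (mapt fs (\<lambda>a. pos a)) (sing (bind fs (\<lambda>a. neg a)))))"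

definition gate_ins :: "tree \<Rightarrow> tree" where
  "gate_ins g = (if left g = Leaf then sing (right g) else right g)"

text \<open>Disjunction reduces to conjunction by De Morgan's law, as \<open>negate\<close> only
  swaps the two forms.\<close>

definition gate_form :: "tree \<Rightarrow> tree \<Rightarrow> tree" where
  "gate_form tab g =
    (if left g = Leaf then negate (nth_tree tab (right g))
     else if right (left g) = Leaf then conj_forms (mapt (gate_ins g) (\<lambda>i. nth_tree tab i))
     else negate (conj_forms (mapt (gate_ins g) (\<lambda>i. negate (nth_tree tab i)))))"

context
  fixes pk :: "nat \<Rightarrow> bool"
begin

text \<open>Forms are built without knowledge of the picks; \<open>pk\<close> enters only their
  semantics, so one form serves every choice.\<close>

definition avoids :: "tree \<Rightarrow> bool" where
  "avoids S \<longleftrightarrow> (\<forall>v\<in>set (lst S). \<not> pk (len v))"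

definition dnf :: "tree \<Rightarrow> bool" where
  "dnf D \<longleftrightarrow> (\<exists>S\<in>set (lst D). avoids S)"

definition cnf :: "tree \<Rightarrow> bool" where
  "cnf C \<longleftrightarrow> (\<forall>D\<in>set (lst C). dnf D)"

lemma dnf_app [simp]: "dnf (app D D') \<longleftrightarrow> dnf D \<or> dnf D'"
  by (auto simp: dnf_def)

lemma cnf_app [simp]: "cnf (app C C') \<longleftrightarrow> cnf C \<and> cnf C'"
  by (auto simp: cnf_def)

lemma dnf_cross [simp]: "dnf (cross D D') \<longleftrightarrow> dnf D \<and> dnf D'"
  by (auto simp: dnf_def cross_def avoids_def)

lemma cnf_cross [simp]: "cnf (cross C C') \<longleftrightarrow> cnf C \<or> cnf C'"
  by (auto simp: cnf_def cross_def)

lemma cnf_sing [simp]: "cnf (sing D) \<longleftrightarrow> dnf D"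
  by (auto simp: cnf_def)

lemma dnf_bind [simp]: "dnf (bind l f) \<longleftrightarrow> (\<exists>a\<in>set (lst l). dnf (f a))"
  by (auto simp: dnf_def)

lemma cnf_mapt [simp]: "cnf (mapt l f) \<longleftrightarrow> (\<forall>a\<in>set (lst l). dnf (f a))"
  by (auto simp: cnf_def)

text \<open>\<open>form ok w b a\<close>: if \<open>ok\<close> holds and the weft is \<open>w \<le> 1\<close>, then \<open>a\<close> is a form of weft \<open>w\<close> with
  truth value \<open>b\<close>; otherwise it is the error value \<open>Leaf\<close>.\<close>

definition form :: "bool \<Rightarrow> nat \<Rightarrow> bool \<Rightarrow> tree \<Rightarrow> bool" where
  "form ok w b a \<longleftrightarrow> (if ok \<and> w \<le> 1 then a \<noteq> Leaf \<and> (left a = Leaf \<longleftrightarrow> w = 0) \<and>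
     (if w = 0 then (dnf (pos a) \<longleftrightarrow> b) \<and> (dnf (neg a) \<longleftrightarrow> \<not> b)
      else (cnf (pos a) \<longleftrightarrow> b) \<and> (cnf (neg a) \<longleftrightarrow> \<not> b)) else a = Leaf)"

lemma form_Leaf: "form ok w b a \<Longrightarrow> a = Leaf \<longleftrightarrow> \<not> (ok \<and> w \<le> 1)"
  by (simp add: form_def split: if_splits)

lemma form_left: "form ok w b a \<Longrightarrow> a \<noteq> Leaf \<Longrightarrow> left a = Leaf \<longleftrightarrow> w = 0"
  by (simp add: form_def split: if_splits)

lemma form_negate: "form ok w b a \<Longrightarrow> form ok w (\<not> b) (negate a)"
  by (auto simp: form_def negate_def pos_def neg_def split: if_splits)

lemma form_upgrade:
  assumes "form ok w b a" "a \<noteq> Leaf"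
  shows "(cnf (pos (upgrade a)) \<longleftrightarrow> b) \<and> (cnf (neg (upgrade a)) \<longleftrightarrow> \<not> b)"
  using assms by (auto simp: form_def upgrade_def pos_def neg_def split: if_splits)

lemma form_and2:
  assumes "form True w b a" "form True w' b' a'" "w \<le> 1" "w' \<le> 1"
  shows "form True (max w w') (b \<and> b') (and2 a a')"
proof -
  have ne: "a \<noteq> Leaf" "a' \<noteq> Leaf" using assms form_Leaf by blast+
  note l = form_left[OF assms(1) ne(1)] form_left[OF assms(2) ne(2)]
  show ?thesis
  proof (cases "w = 0 \<and> w' = 0")
    case True
    then have "and2 a a' = Node Leaf (Node (cross (pos a) (pos a')) (app (neg a) (neg a')))"
      using l by (simp add: and2_def)
    moreover have "dnf (pos a) \<longleftrightarrow> b" "dnf (neg a) \<longleftrightarrow> \<not> b" "dnf (pos a') \<longleftrightarrow> b'" "dnf (neg a') \<longleftrightarrow> \<not> b'"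
      using assms True by (auto simp: form_def)
    ultimately show ?thesis using True by (simp add: form_def pos_def[of "Node _ _"] neg_def[of "Node _ _"])
  next
    case False
    then have "and2 a a' = Node (num 1) (Node (app (pos (upgrade a)) (pos (upgrade a')))
      (cross (neg (upgrade a)) (neg (upgrade a'))))"
      using l by (simp add: and2_def)
    moreover have "max w w' = 1" using False assms by linarith
    ultimately show ?thesis using form_upgrade[OF assms(1) ne(1)] form_upgrade[OF assms(2) ne(2)]
      by (simp add: form_def pos_def[of "Node _ _"] neg_def[of "Node _ _"])
  qed
qed

text \<open>An erroneous input violates \<open>ok\<close> or has weft above 1, and the gate inherits
  this. A large gate over an input of weft 1 has weft at least 2 and has to become an error.\<close>

lemma form_conj:
  assumes ne: "is \<noteq> []" and f: "\<And>i. i \<in> set is \<Longrightarrow> form (ok i) (w i) (b i) (A i)"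
    and fs: "lst fs = map A is"
  shows "form (\<forall>i\<in>set is. ok i) ((if length is > 2 then 1 else 0) + Max (w ` set is))
    (\<forall>i\<in>set is. b i) (conj_forms fs)"
proof -
  define W where "W = (if length is > 2 then 1 else 0) + Max (w ` set is)"
  have wW: "w i \<le> W" if "i \<in> set is" for i
  proof -
    have "w i \<le> Max (w ` set is)" using that by simp
    then show ?thesis unfolding W_def by simp
  qed
  have "form (\<forall>i\<in>set is. ok i) W (\<forall>i\<in>set is. b i) (conj_forms fs)"
  proof (cases "\<exists>i\<in>set is. A i = Leaf")
    case True
    then obtain i where i: "i \<in> set is" "A i = Leaf" by blast
    then have "\<not> (ok i \<and> w i \<le> 1)" using form_Leaf[OF f[OF i(1)]] by blast
    then have "\<not> ((\<forall>i\<in>set is. ok i) \<and> W \<le> 1)" using i(1) wW by fastforce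
    moreover have "conj_forms fs = Leaf" using i fs unfolding conj_forms_def by force
    ultimately show ?thesis by (auto simp: form_def)
  next
    case False
    then have ok: "ok i" "w i \<le> 1" if "i \<in> set is" for i
      using form_Leaf[OF f[OF that]] that by blast+
    then have f1: "form True (w i) (b i) (A i)" if "i \<in> set is" for i using f that by force
    have lf: "left (A i) = Leaf \<longleftrightarrow> w i = 0" if "i \<in> set is" for i
      using form_left[OF f[OF that]] False that by blast
    \<comment> \<open>Fan-in is measured by list length, repetitions included, exactly as in
      \<open>weft\<close>.\<close>
    have tl2: "right (right fs) = Leaf \<longleftrightarrow> length is \<le> 2"
    proof -
      have "right (right fs) = Leaf \<longleftrightarrow> tl (tl (lst fs)) = []" by (simp flip: lst_eq_Nil)
      also have "\<dots> \<longleftrightarrow> len fs \<le> 2" by (cases "lst fs"; cases "tl (lst fs)") auto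
      finally show ?thesis using fs by simp
    qed
    have nl: "\<not> (\<exists>a\<in>set (lst fs). a = Leaf)" using False fs by auto
    show ?thesis
    proof (cases "right (right fs) = Leaf")
      case True
      then have "length is \<le> 2" unfolding tl2 .
      then consider i where "is = [i]" | i j where "is = [i, j]"
        using ne by (cases "is" rule: list.exhaust; cases "tl is" rule: list.exhaust) auto
      then show ?thesis
      proof cases
        case 1
        then have "fs = sing (A i)" using fs by (metis enc_list_lst lst_sing list.simps(8,9))
        then have "conj_forms fs = and2 (A i) (A i)" using nl unfolding conj_forms_def by (simp add: sing_def)
        then show ?thesis using form_and2[OF f1 f1, of i i] ok 1 unfolding W_def by simp
      next
        case 2
        then have "fs = Node (A i) (sing (A j))" using fs by (simp add: lst_inject[symmetric])
        then have "conj_forms fs = and2 (A i) (A j)" using nl unfolding conj_forms_def by (simp add: sing_def)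
        then show ?thesis using form_and2[OF f1 f1, of i j] ok 2 unfolding W_def by simp
      qed
    next
      case len: False
      then have "length is > 2" unfolding tl2 by simp
      then have W: "W = 1 + Max (w ` set is)" unfolding W_def by simp
      show ?thesis
      proof (cases "\<exists>i\<in>set is. w i \<noteq> 0")
        case True
        then obtain i where i: "i \<in> set is" "w i \<noteq> 0" by blast
        have "w i \<le> Max (w ` set is)" using i by simp
        then have "W > 1" using i(2) unfolding W by linarith
        moreover have "\<exists>a\<in>set (lst fs). left a \<noteq> Leaf" using i fs lf by force
        then have "conj_forms fs = Leaf" using nl len unfolding conj_forms_def by simp
        ultimately show ?thesis by (auto simp: form_def)
      next
        case w0: False
        then have "w ` set is = {0}" using ne by (cases "is") auto
        then have "W = 1" unfolding W by simp
        moreover have "\<not> (\<exists>a\<in>set (lst fs). left a \<noteq> Leaf)" using w0 fs lf by auto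
        then have "conj_forms fs = Node (num 1) (Node (mapt fs (\<lambda>a. pos a)) (sing (bind fs (\<lambda>a. neg a))))"
          using nl len unfolding conj_forms_def by simp
        moreover have "dnf (pos (A i)) \<longleftrightarrow> b i" "dnf (neg (A i)) \<longleftrightarrow> \<not> b i" if "i \<in> set is" for i
          using f1[OF that] w0 that by (auto simp: form_def)
        ultimately show ?thesis using ok fs
          by (simp add: form_def pos_def[of "Node _ _"] neg_def[of "Node _ _"])
      qed
    qed
  qed
  then show ?thesis unfolding W_def .
qed

lemma form_gate:
  assumes fin: "fan_in g \<noteq> []"
    and f: "\<And>i. i \<in> set (fan_in g) \<Longrightarrow> i < len tab \<and> form (d i \<le> r) (w i) (b i) (lst tab ! i)"
  shows "form (1 + Max (d ` set (fan_in g)) \<le> Suc r)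
    ((if length (fan_in g) > 2 then 1 else 0) + Max (w ` set (fan_in g)))
    (gate_sem b g) (gate_form tab (enc_gate g))"
proof -
  let ?A = "\<lambda>i. nth_tree tab (num i)"
  have A: "form (d i \<le> r) (w i) (b i) (?A i)" if "i \<in> set (fan_in g)" for i
    using f[OF that] by (simp add: nth_tree)
  have d: "1 + Max (d ` set (fan_in g)) \<le> Suc r \<longleftrightarrow> (\<forall>i\<in>set (fan_in g). d i \<le> r)"
    using fin by simp
  show ?thesis
  proof (cases g)
    case (GNot i)
    then show ?thesis using form_negate[OF A[of i]] by (simp add: gate_form_def)
  next
    case (GAnd js)
    then have "gate_form tab (enc_gate g) = conj_forms (mapt (enc_nats js) (\<lambda>i. nth_tree tab i))"
      by (simp add: gate_form_def gate_ins_def)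
    moreover have "lst (mapt (enc_nats js) (\<lambda>i. nth_tree tab i)) = map ?A js"
      by (simp add: enc_nats_def)
    ultimately show ?thesis using form_conj[OF fin A, where fs = "mapt (enc_nats js) (\<lambda>i. nth_tree tab i)"] GAnd
      unfolding d by simp
  next
    case (GOr js)
    let ?fs = "mapt (enc_nats js) (\<lambda>i. negate (nth_tree tab i))"
    have "gate_form tab (enc_gate g) = negate (conj_forms ?fs)"
      using GOr by (simp add: gate_form_def gate_ins_def numeral_2_eq_2)
    moreover have "lst ?fs = map (\<lambda>i. negate (?A i)) js"
      by (simp add: enc_nats_def)
    ultimately show ?thesis
      using form_negate[OF form_conj[OF fin form_negate[OF A], where fs = ?fs]] GOr unfolding d by simp
  qed
qed

end

section \<open>From circuits to clauses\<close>

definition vert :: "tree \<Rightarrow> tree \<Rightarrow> tree \<Rightarrow> tree" where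
  "vert N i a = norm (app (mul i N) a)"

lemma vert_eq: "vert N i a = num (len i * len N + len a)"
  by (simp add: vert_def norm_eq mul_eq)

definition input_form :: "tree \<Rightarrow> tree \<Rightarrow> tree \<Rightarrow> tree" where
  "input_form N K a = Node Leaf (Node
    (mapt (range_tree K) (\<lambda>i. bind (range_tree N) (\<lambda>b. if len b = len a then Leaf else sing (vert N i b))))
    (sing (mapt (range_tree K) (\<lambda>i. vert N i a))))"

definition table_step :: "tree \<Rightarrow> tree \<Rightarrow> tree \<Rightarrow> tree \<Rightarrow> tree" where
  "table_step N K gs tab = app (mapt (range_tree N) (\<lambda>a. input_form N K a)) (mapt gs (\<lambda>g. gate_form tab g))"

text \<open>Recomputing the table \<open>d\<close> times, instead of one pass in topological order, keeps all entries
  of polynomial size: nodes of depth greater than \<open>d\<close> never get a form.\<close>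

primrec table :: "nat \<Rightarrow> tree \<Rightarrow> tree \<Rightarrow> tree \<Rightarrow> tree" where
  "table 0 N K gs = app (mapt (range_tree N) (\<lambda>a. input_form N K a)) (mapt gs (\<lambda>_. Leaf))"
| "table (Suc r) N K gs = table_step N K gs (table r N K gs)"

text \<open>\<open>right tab\<close> is one entry shorter than \<open>tab\<close>, so read as a
  number it is the index of the last node.\<close>

definition output_form :: "nat \<Rightarrow> tree \<Rightarrow> tree \<Rightarrow> tree" where
  "output_form d x K = (let tab = table d (left x) K (right x) in nth_tree tab (right tab))"

text \<open>Each clause says that two different picks do not both choose \<open>a\<close>. Together
  they make the chosen inputs a set of exactly \<open>k\<close> elements.\<close>

definition distinct_clauses :: "tree \<Rightarrow> tree \<Rightarrow> tree" where
  "distinct_clauses N K = bind (range_tree N) (\<lambda>a. bind (range_tree K) (\<lambda>i. bind (range_tree K) (\<lambda>j.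
    if len i = len j then Leaf else sing (Node (sing (vert N i a)) (sing (sing (vert N j a)))))))"

definition clauses :: "tree \<Rightarrow> tree \<Rightarrow> tree \<Rightarrow> tree" where
  "clauses N K a = app (pos (upgrade a)) (distinct_clauses N K)"

definition picked :: "nat \<Rightarrow> nat \<Rightarrow> (nat \<Rightarrow> nat) \<Rightarrow> nat \<Rightarrow> bool" where
  "picked n k \<sigma> v \<longleftrightarrow> (\<exists>i<k. v = i * n + \<sigma> i)"

context
  fixes n k :: nat and \<sigma> :: "nat \<Rightarrow> nat"
  assumes \<sigma>: "\<And>i. i < k \<Longrightarrow> \<sigma> i < n"
begin

lemma picked_index: "i < k \<Longrightarrow> a < n \<Longrightarrow> picked n k \<sigma> (i * n + a) \<longleftrightarrow> \<sigma> i = a"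
  unfolding picked_def using index_inj \<sigma> by metis

lemma form_input:
  assumes a: "a < n"
  shows "form (picked n k \<sigma>) True 0 (a \<in> \<sigma> ` {..<k}) (input_form (num n) (num k) (num a))"
proof -
  let ?P = "picked n k \<sigma>"
  let ?S = "\<lambda>i. bind (range_tree (num n)) (\<lambda>b. if len b = len (num a) then Leaf else sing (vert (num n) i b))"
  have 1: "avoids ?P (?S (num i)) \<longleftrightarrow> \<sigma> i = a" if "i < k" for i
  proof -
    have "avoids ?P (?S (num i)) \<longleftrightarrow> (\<forall>b<n. b \<noteq> a \<longrightarrow> \<not> ?P (i * n + b))"
      by (auto simp: avoids_def vert_eq)
    \<comment> \<open>Pick \<open>i\<close> takes exactly one value below \<open>n\<close>, so
      avoiding all others means taking \<open>a\<close>.\<close>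
    also have "\<dots> \<longleftrightarrow> \<sigma> i = a" using picked_index[OF that] \<sigma>[OF that] a by metis
    finally show ?thesis .
  qed
  have 2: "dnf ?P (mapt (range_tree (num k)) ?S) \<longleftrightarrow> (\<exists>i<k. avoids ?P (?S (num i)))"
    by (auto simp: dnf_def)
  have 3: "dnf ?P (sing (mapt (range_tree (num k)) (\<lambda>i. vert (num n) i (num a)))) \<longleftrightarrow> (\<forall>i<k. \<not> ?P (i * n + a))"
    by (auto simp: dnf_def avoids_def vert_eq)
  have "(\<exists>i<k. avoids ?P (?S (num i))) \<longleftrightarrow> a \<in> \<sigma> ` {..<k}" using 1 by auto
  moreover have "(\<forall>i<k. \<not> ?P (i * n + a)) \<longleftrightarrow> a \<notin> \<sigma> ` {..<k}" using picked_index[OF _ a] by auto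
  ultimately show ?thesis unfolding form_def input_form_def
    using 2 3 by (simp add: pos_def neg_def)
qed

lemma cnf_distinct: "cnf (picked n k \<sigma>) (distinct_clauses (num n) (num k)) \<longleftrightarrow> inj_on \<sigma> {..<k}"
proof -
  let ?P = "picked n k \<sigma>"
  let ?D = "\<lambda>a i j. Node (sing (num (i * n + a))) (sing (sing (num (j * n + a))))"
  have D: "D \<in> set (lst (distinct_clauses (num n) (num k))) \<longleftrightarrow>
      (\<exists>a<n. \<exists>i<k. \<exists>j<k. i \<noteq> j \<and> D = ?D a i j)" for D
    by (simp add: distinct_clauses_def vert_eq Bex_def if_distrib[of lst] if_distrib[of set] cong: if_cong)
  have E: "dnf ?P (?D a i j) \<longleftrightarrow> \<not> ?P (i * n + a) \<or> \<not> ?P (j * n + a)" for a i j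
    by (simp add: dnf_def avoids_def)
  have "cnf ?P (distinct_clauses (num n) (num k)) \<longleftrightarrow>
      (\<forall>a<n. \<forall>i<k. \<forall>j<k. i \<noteq> j \<longrightarrow> dnf ?P (?D a i j))"
    unfolding cnf_def Ball_def D by fast
  then have "cnf ?P (distinct_clauses (num n) (num k)) \<longleftrightarrow>
      (\<forall>a<n. \<forall>i<k. \<forall>j<k. i \<noteq> j \<longrightarrow> \<sigma> i \<noteq> a \<or> \<sigma> j \<noteq> a)"
    unfolding E using picked_index by simp
  also have "\<dots> \<longleftrightarrow> inj_on \<sigma> {..<k}" unfolding inj_on_def using \<sigma> by auto
  finally show ?thesis .
qed

end

lemma len_table: "len (table r N K gs) = len N + len gs"
  by (cases r) (auto simp: table_step_def)

text \<open>A gate has depth at most \<open>Suc r\<close> iff its inputs have depth at most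
  \<open>r\<close>. Those have correct entries in the previous table, while deeper inputs are
  \<open>Leaf\<close> there and pass the error on.\<close>

lemma form_table:
  assumes wf: "wf_circuit C" and \<sigma>: "\<And>i. i < k \<Longrightarrow> \<sigma> i < inputs C"
    and x: "gs = enc_list (map enc_gate (gates C))"
  shows "v < inputs C + length (gates C) \<Longrightarrow>
    form (picked (inputs C) k \<sigma>) (node_path (\<lambda>_. 1) C v \<le> r)
      (node_path (\<lambda>g. if length (fan_in g) > 2 then 1 else 0) C v)
      (node_val (\<sigma> ` {..<k}) C v) (lst (table r (num (inputs C)) (num k) gs) ! v)"
proof (induction r arbitrary: v)
  let ?n = "inputs C"
  have input: "form (picked ?n k \<sigma>) (node_path (\<lambda>_. 1) C v \<le> r)
      (node_path (\<lambda>g. if length (fan_in g) > 2 then 1 else 0) C v)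
      (node_val (\<sigma> ` {..<k}) C v) (lst (table r (num ?n) (num k) gs) ! v)" if "v < ?n" for v r
  proof -
    have "lst (table r (num ?n) (num k) gs) ! v = input_form (num ?n) (num k) (num v)"
      using that by (cases r) (auto simp: table_step_def nth_append)
    then show ?thesis using form_input[of k \<sigma> ?n v, OF \<sigma> that] that
      by (simp add: node_path_def node_val_def node_attrs_input)
  qed
  {
    case 0
    show ?case
    proof (cases "v < ?n")
      case False
      then obtain j where j: "v = ?n + j" "j < length (gates C)" using 0 by (metis add_diff_inverse_nat nat_add_left_cancel_less)
      then have "lst (table 0 (num ?n) (num k) gs) ! v = Leaf" by (simp add: nth_append x)
      \<comment> \<open>A gate has depth at least 1, so the error value is required here.\<close>
      then show ?thesis unfolding j(1) node_path_gate[OF wf j(2)] by (simp add: form_def)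
    qed (rule input)
  next
    case (Suc r)
    show ?case
    proof (cases "v < ?n")
      case False
      then obtain j where j: "v = ?n + j" "j < length (gates C)" using Suc.prems by (metis add_diff_inverse_nat nat_add_left_cancel_less)
      let ?g = "gates C ! j" and ?t = "table r (num ?n) (num k) gs"
      have g: "fan_in ?g \<noteq> []" "\<And>i. i \<in> set (fan_in ?g) \<Longrightarrow> i < ?n + j"
        using wf j unfolding wf_circuit_def by blast+
      have "lst (table (Suc r) (num ?n) (num k) gs) ! (?n + j) = gate_form ?t (enc_gate ?g)"
        using j by (simp add: table_step_def nth_append x)
      then show ?thesis unfolding j(1) node_path_gate[OF wf j(2)] node_val_gate[OF wf j(2)]
      proof (simp only:, intro form_gate g(1))
        fix i assume "i \<in> set (fan_in ?g)"
        then have "i < ?n + length (gates C)" using g(2)[of i] j(2) by linarith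
        then show "i < len ?t \<and> form (picked ?n k \<sigma>) (node_path (\<lambda>_. 1) C i \<le> r)
          (node_path (\<lambda>g. if length (fan_in g) > 2 then 1 else 0) C i)
          (node_val (\<sigma> ` {..<k}) C i) (lst ?t ! i)"
          using Suc.IH by (simp add: len_table x)
      qed
    qed (rule input)
  }
qed

text \<open>Without inputs the first gate would have nothing to read, although its fan-in is
  nonempty.\<close>

lemma wf_circuit_inputs: assumes "wf_circuit C" shows "inputs C > 0"
proof (rule ccontr)
  assume "\<not> inputs C > 0"
  then have "fan_in (gates C ! 0) \<noteq> [] \<and> (\<forall>i\<in>set (fan_in (gates C ! 0)). i < 0)"
    using assms unfolding wf_circuit_def by auto
  then show False by (cases "fan_in (gates C ! 0)") auto
qed

lemma form_output:
  assumes wf: "wf_circuit C" and \<sigma>: "\<And>i. i < k \<Longrightarrow> \<sigma> i < inputs C"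
  shows "form (picked (inputs C) k \<sigma>) (depth C \<le> d) (weft C) (satisfies (\<sigma> ` {..<k}) C)
    (output_form d (enc_circuit C) (num k))"
proof -
  have pos: "inputs C + length (gates C) > 0" using wf_circuit_inputs[OF wf] by simp
  define gs where "gs = enc_list (map enc_gate (gates C))"
  let ?t = "table d (num (inputs C)) (num k) gs"
  have "output_form d (enc_circuit C) (num k) = nth_tree ?t (right ?t)"
    by (simp add: output_form_def enc_circuit_def gs_def Let_def)
  also have "\<dots> = lst ?t ! (inputs C + length (gates C) - 1)"
    using pos by (subst nth_tree) (simp_all add: len_table gs_def)
  finally show ?thesis
    using form_table[OF wf, of k \<sigma> gs "inputs C + length (gates C) - 1" d] \<sigma> gs_def pos
    unfolding depth_def weft_def satisfies_def max_path_def last_node_attrs[OF pos] node_path_def node_val_def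
    by simp
qed

section \<open>Recognising circuits\<close>

text \<open>The reduction must handle all trees, so codes of well-formed circuits have to be
  recognised. The length of \<open>N\<close> counts the nodes that precede the gate.\<close>

definition gate_ok :: "tree \<Rightarrow> tree \<Rightarrow> bool" where
  "gate_ok N g \<longleftrightarrow> g \<noteq> Leaf \<and> is_unary (left g) \<and> len (left g) < len (num 3) \<and> gate_ins g \<noteq> Leaf \<and>
    (\<forall>i\<in>set (lst (gate_ins g)). is_unary i \<and> len i < len N)"

definition circuit_ok :: "tree \<Rightarrow> bool" where
  "circuit_ok x \<longleftrightarrow> x \<noteq> Leaf \<and> is_unary (left x) \<and> (left x \<noteq> Leaf \<or> right x \<noteq> Leaf) \<and>
    (\<forall>q\<in>set (lst (enumt (right x))). gate_ok (app (left x) (left q)) (right q))"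

lemma is_unary_num [simp]: "is_unary (num n)"
  by (simp add: is_unary)

lemma lst_enc_nats [simp]: "lst (enc_nats ns) = map num ns"
  by (simp add: enc_nats_def)

lemma gate_ok: "gate_ok N g \<longleftrightarrow>
  (\<exists>G. g = enc_gate G \<and> fan_in G \<noteq> [] \<and> (\<forall>i\<in>set (fan_in G). i < len N))"
proof
  assume ok: "gate_ok N g"
  then have g: "g = Node (left g) (right g)" by (cases g) (auto simp: gate_ok_def)
  have l: "left g = num (len (left g))" using ok is_unary unfolding gate_ok_def by blast
  have "len (left g) < 3" using ok by (simp add: gate_ok_def)
  then consider "len (left g) = 0" | "len (left g) = 1" | "len (left g) = 2" by linarith
  then show "\<exists>G. g = enc_gate G \<and> fan_in G \<noteq> [] \<and> (\<forall>i\<in>set (fan_in G). i < len N)"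
  proof cases
    case 1
    then have "left g = Leaf" using l by simp
    then have "is_unary (right g)" "len (right g) < len N" using ok by (auto simp: gate_ok_def gate_ins_def)
    then have "g = enc_gate (GNot (len (right g)))" using g \<open>left g = Leaf\<close> is_unary[of "right g"] by simp
    then show ?thesis using \<open>len (right g) < len N\<close> by (intro exI[of _ "GNot (len (right g))"]) simp
  next
    case 2
    let ?is = "map len (lst (right g))"
    have ne: "left g \<noteq> Leaf" using 2 by auto
    have ins: "gate_ins g = right g" using ne by (simp add: gate_ins_def)
    have *: "\<forall>i\<in>set (lst (right g)). i = num (len i) \<and> len i < len N"
      using ok ins is_unary by (simp add: gate_ok_def)
    then have "map num ?is = lst (right g)" by (auto intro!: map_idI)
    then have "right g = enc_nats ?is" unfolding enc_nats_def by (metis enc_list_lst)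
    then have "g = Node (num 1) (enc_nats ?is)" using g l 2 by metis
    then have "g = enc_gate (GAnd ?is)" by (simp only: enc_gate.simps)
    moreover have "lst (right g) \<noteq> []" using ok ins by (metis gate_ok_def lst_eq_Nil)
    ultimately show ?thesis using * by (intro exI[of _ "GAnd ?is"]) auto
  next
    case 3
    let ?is = "map len (lst (right g))"
    have ne: "left g \<noteq> Leaf" using 3 by auto
    have ins: "gate_ins g = right g" using ne by (simp add: gate_ins_def)
    have *: "\<forall>i\<in>set (lst (right g)). i = num (len i) \<and> len i < len N"
      using ok ins is_unary by (simp add: gate_ok_def)
    then have "map num ?is = lst (right g)" by (auto intro!: map_idI)
    then have "right g = enc_nats ?is" unfolding enc_nats_def by (metis enc_list_lst)
    then have "g = Node (num 2) (enc_nats ?is)" using g l 3 by metis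
    then have "g = enc_gate (GOr ?is)" by (simp only: enc_gate.simps)
    moreover have "lst (right g) \<noteq> []" using ok ins by (metis gate_ok_def lst_eq_Nil)
    ultimately show ?thesis using * by (intro exI[of _ "GOr ?is"]) auto
  qed
next
  assume "\<exists>G. g = enc_gate G \<and> fan_in G \<noteq> [] \<and> (\<forall>i\<in>set (fan_in G). i < len N)"
  then obtain G where G: "g = enc_gate G" "fan_in G \<noteq> []" "\<forall>i\<in>set (fan_in G). i < len N" by blast
  have e: "enc_nats is \<noteq> Leaf \<longleftrightarrow> is \<noteq> []" for "is" by (cases "is") (auto simp: enc_nats_def)
  show "gate_ok N g"
    using G by (cases G)
      (auto simp: gate_ok_def gate_ins_def e lst_enc_nats is_unary_def sing_def numeral_2_eq_2)
qed

lemma circuit_ok: "circuit_ok x \<longleftrightarrow> (\<exists>C. x = enc_circuit C \<and> wf_circuit C)"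
proof
  assume ok: "circuit_ok x"
  let ?gs = "lst (right x)"
  have x: "x = Node (num (len (left x))) (right x)"
    using ok is_unary[of "left x"] by (cases x) (auto simp: circuit_ok_def)
  have "\<exists>G. ?gs ! j = enc_gate G \<and> fan_in G \<noteq> [] \<and> (\<forall>i\<in>set (fan_in G). i < len (left x) + j)"
    if "j < length ?gs" for j
  proof -
    have "Node (num j) (?gs ! j) \<in> set (lst (enumt (right x)))"
      using that by (force simp: in_set_enumerate_eq)
    then have "gate_ok (app (left x) (num j)) (?gs ! j)" using ok unfolding circuit_ok_def by fastforce
    then show ?thesis unfolding gate_ok by simp
  qed
  then obtain Gs where Gs: "length Gs = length ?gs" "\<And>j. j < length ?gs \<Longrightarrow> ?gs ! j = enc_gate (Gs ! j) \<and>
      fan_in (Gs ! j) \<noteq> [] \<and> (\<forall>i\<in>set (fan_in (Gs ! j)). i < len (left x) + j)"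
    using Skolem_list_nth[of "length ?gs" "\<lambda>j G. ?gs ! j = enc_gate G \<and> fan_in G \<noteq> [] \<and> (\<forall>i\<in>set (fan_in G). i < len (left x) + j)"]
    by metis
  have "?gs = map enc_gate Gs" using Gs by (intro nth_equalityI) auto
  then have "right x = enc_list (map enc_gate Gs)" by (metis enc_list_lst)
  let ?C = "\<lparr>inputs = len (left x), gates = Gs\<rparr>"
  have "x = enc_circuit ?C" using x \<open>right x = _\<close> by (simp add: enc_circuit_def)
  moreover have "len (left x) + length ?gs > 0" 
    using ok unfolding circuit_ok_def by (metis add_gr_0 length_greater_0_conv lst_eq_Nil)
  then have "wf_circuit ?C" using Gs by (auto simp: wf_circuit_def)
  ultimately show "\<exists>C. x = enc_circuit C \<and> wf_circuit C" by blast
next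
  assume "\<exists>C. x = enc_circuit C \<and> wf_circuit C"
  then obtain C where C: "x = enc_circuit C" "wf_circuit C" by blast
  have "num (inputs C) \<noteq> Leaf" using wf_circuit_inputs[OF C(2)] by (cases "inputs C") auto
  moreover have "gate_ok (app (num (inputs C)) (num j)) (enc_gate (gates C ! j))" if "j < length (gates C)" for j
    using C(2) that unfolding gate_ok wf_circuit_def by (intro exI[of _ "gates C ! j"]) simp
  ultimately show "circuit_ok x" unfolding C(1) circuit_ok_def
    by (auto simp: enc_circuit_def in_set_enumerate_eq)
qed

section \<open>Injectivity of the encodings\<close>

lemma num_inject [simp]: "num a = num b \<longleftrightarrow> a = b"
  by (metis length_replicate lst_num)

lemma enc_list_inject [simp]: "enc_list xs = enc_list ys \<longleftrightarrow> xs = ys"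
  by (metis lst_enc_list)

lemma map_num_inject [simp]: "map num xs = map num ys \<longleftrightarrow> xs = ys"
  by (rule inj_map_eq_map) (simp add: inj_def)

lemma enc_nats_inject [simp]: "enc_nats xs = enc_nats ys \<longleftrightarrow> xs = ys"
  by (simp add: enc_nats_def)

lemma enc_pairs_inject [simp]: "enc_pairs xs = enc_pairs ys \<longleftrightarrow> xs = ys"
proof -
  have "inj (\<lambda>(u, v). Node (num u) (num v))" by (auto simp: inj_def)
  then show ?thesis by (simp add: enc_pairs_def inj_map_eq_map)
qed

lemma enc_gate_inject [simp]: "enc_gate G = enc_gate H \<longleftrightarrow> G = H"
  by (cases G; cases H) (auto simp: numeral_2_eq_2)

lemma enc_circuit_inject [simp]: "enc_circuit C = enc_circuit D \<longleftrightarrow> C = D"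
proof -
  have "map enc_gate xs = map enc_gate ys \<longleftrightarrow> xs = ys" for xs ys
    by (rule inj_map_eq_map) (simp add: inj_def)
  then show ?thesis by (auto simp: enc_circuit_def)
qed

lemma enc_inst_inject [simp]: "enc_inst J = enc_inst J' \<longleftrightarrow> J = J'"
  by (auto simp: enc_inst_def)

text \<open>By injectivity the code determines the circuit, which removes the existential quantifier
  in \<open>WCS\<close>.\<close>

lemma WCS_iff: "(enc_circuit C, k) \<in> WCS t d \<longleftrightarrow> wf_circuit C \<and> weft C \<le> t \<and> depth C \<le> d \<and>
    (\<exists>A \<subseteq> {..<inputs C}. card A = k \<and> satisfies A C)"
  unfolding WCS_def by auto

lemma BERD_iff: "(enc_inst J, param J) \<in> BERD \<longleftrightarrow> wf_inst J \<and>
    (\<exists>g. minimal_rdf (verts J) (edges J) g \<and>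
      (\<forall>v \<in> verts J. lower J ! v \<le> g v \<and> g v \<le> upper J ! v))"
  unfolding BERD_def by auto

section \<open>The reduction\<close>

text \<open>Clause numbers are attached before flattening, so a clause without terms still owns a
  clause vertex.\<close>

definition terms :: "tree \<Rightarrow> tree" where
  "terms CL = bind (enumt CL) (\<lambda>q. mapt (right q) (\<lambda>S. Node (left q) S))"

text \<open>Dropping numbers from \<open>B\<close> on makes the hypothesis of the gadget hold for
  every tree of clauses. With \<open>B = k * n\<close> truth is unaffected, since picked candidates
  have smaller numbers.\<close>

definition term_nums :: "nat \<Rightarrow> tree \<Rightarrow> nat \<times> nat list" where
  "term_nums B t = (len (left t), filter (\<lambda>v. v < B) (map len (lst (right t))))"

definition inst :: "nat \<Rightarrow> nat \<Rightarrow> tree \<Rightarrow> berd_inst" where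
  "inst n k CL = gadget n k (len CL) (map (term_nums (k * n)) (lst (terms CL)))"

lemma lst_terms: "lst (terms CL) =
    concat (map (\<lambda>(c, D). map (\<lambda>S. Node (num c) S) (lst D)) (enumerate 0 (lst CL)))"
  by (simp add: terms_def o_def case_prod_unfold)

lemma set_terms: "t \<in> set (lst (terms CL)) \<longleftrightarrow>
    (\<exists>c<len CL. \<exists>S\<in>set (lst (lst CL ! c)). t = Node (num c) S)"
proof -
  have "t \<in> set (lst (terms CL)) \<longleftrightarrow>
      (\<exists>q\<in>set (enumerate 0 (lst CL)). \<exists>S\<in>set (lst (snd q)). t = Node (num (fst q)) S)"
    by (auto simp: lst_terms case_prod_unfold)
  then show ?thesis unfolding Bex_def in_set_enumerate_eq by fastforce
qed

lemma terms_less: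
  "(c, S) \<in> set (map (term_nums (k * n)) (lst (terms CL))) \<Longrightarrow> c < len CL \<and> (\<forall>v\<in>set S. v < k * n)"
  by (auto simp: lst_terms term_nums_def in_set_enumerate_eq)

lemma terms_iff_cnf:
  assumes \<sigma>: "\<And>i. i < k \<Longrightarrow> \<sigma> i < n"
  shows "(\<forall>c<len CL. \<exists>(c', S)\<in>set (map (term_nums (k * n)) (lst (terms CL))).
      c' = c \<and> (\<forall>i<k. i * n + \<sigma> i \<notin> set S)) \<longleftrightarrow> cnf (picked n k \<sigma>) CL"
proof -
  have av: "(\<forall>i<k. i * n + \<sigma> i \<notin> set (snd (term_nums (k * n) (Node t S)))) \<longleftrightarrow> avoids (picked n k \<sigma>) S" for t S
  proof -
    have "i * n + \<sigma> i < k * n" if "i < k" for i using index_less[OF that \<sigma>[OF that]] .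
    then have "(\<forall>i<k. i * n + \<sigma> i \<notin> set (snd (term_nums (k * n) (Node t S)))) \<longleftrightarrow>
        (\<forall>i<k. \<forall>v\<in>set (lst S). len v \<noteq> i * n + \<sigma> i)"
      by (simp add: term_nums_def image_iff) metis
    then show ?thesis unfolding avoids_def picked_def by blast
  qed
  have "(\<exists>(c', S)\<in>set (map (term_nums (k * n)) (lst (terms CL))). c' = c \<and> (\<forall>i<k. i * n + \<sigma> i \<notin> set S))
      \<longleftrightarrow> (\<exists>S\<in>set (lst (lst CL ! c)). avoids (picked n k \<sigma>) S)" if "c < len CL" for c
  proof -
    have "(\<exists>(c', S)\<in>set (map (term_nums (k * n)) (lst (terms CL))). c' = c \<and> (\<forall>i<k. i * n + \<sigma> i \<notin> set S))
        \<longleftrightarrow> (\<exists>t\<in>set (lst (terms CL)). len (left t) = c \<and> (\<forall>i<k. i * n + \<sigma> i \<notin> set (snd (term_nums (k * n) t))))"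
      by (simp add: term_nums_def)
    also have "\<dots> \<longleftrightarrow> (\<exists>S\<in>set (lst (lst CL ! c)).
        \<forall>i<k. i * n + \<sigma> i \<notin> set (snd (term_nums (k * n) (Node (num c) S))))"
    proof
      assume "\<exists>t\<in>set (lst (terms CL)). len (left t) = c \<and>
        (\<forall>i<k. i * n + \<sigma> i \<notin> set (snd (term_nums (k * n) t)))"
      then obtain t where t: "t \<in> set (lst (terms CL))" "len (left t) = c"
        "\<forall>i<k. i * n + \<sigma> i \<notin> set (snd (term_nums (k * n) t))" by blast
      from t(1) obtain c' S where "S \<in> set (lst (lst CL ! c'))" "t = Node (num c') S"
        unfolding set_terms by blast
      moreover from this have "c' = c" using t(2) by simp
      ultimately show "\<exists>S\<in>set (lst (lst CL ! c)).
          \<forall>i<k. i * n + \<sigma> i \<notin> set (snd (term_nums (k * n) (Node (num c) S)))" using t(3) by blast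
    next
      assume "\<exists>S\<in>set (lst (lst CL ! c)).
          \<forall>i<k. i * n + \<sigma> i \<notin> set (snd (term_nums (k * n) (Node (num c) S)))"
      then obtain S where S: "S \<in> set (lst (lst CL ! c))"
        "\<forall>i<k. i * n + \<sigma> i \<notin> set (snd (term_nums (k * n) (Node (num c) S)))" by blast
      have "Node (num c) S \<in> set (lst (terms CL))" unfolding set_terms using that S(1) by blast
      moreover have "len (left (Node (num c) S)) = c" by simp
      ultimately show "\<exists>t\<in>set (lst (terms CL)). len (left t) = c \<and>
        (\<forall>i<k. i * n + \<sigma> i \<notin> set (snd (term_nums (k * n) t)))" using S(2) by blast
    qed
    finally show ?thesis unfolding av .
  qed
  then show ?thesis by (simp add: cnf_def dnf_def all_set_conv_all_nth)
qed

section \<open>Writing the instance as a tree\<close>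

definition edges_tree :: "tree \<Rightarrow> tree \<Rightarrow> tree \<Rightarrow> tree" where
  "edges_tree N K CL = app
    (bind (range_tree K) (\<lambda>i. mapt (range_tree N) (\<lambda>a. Node (vert N i a) (app (mul K N) i))))
    (bind (enumt (terms CL)) (\<lambda>q.
      Node (Node (norm (app (app (app (mul K N) K) CL) (left q)))
                 (norm (app (app (mul K N) K) (left (right q)))))
        (bind (right (right q)) (\<lambda>v. if len v < len (mul K N)
          then sing (Node (norm (app (app (app (mul K N) K) CL) (left q))) (norm v)) else Leaf))))"

lemma concat_map_filter:
  "concat (map (\<lambda>v. if P v then [f v] else []) xs) = map f (filter P xs)"
  by (induction xs) auto

lemma map_map_filter_len:
  "map f (filter (\<lambda>v. v < B) (map len xs)) = map (\<lambda>v. f (len v)) (filter (\<lambda>v. len v < B) xs)"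
  by (induction xs) auto

lemma enumerate_map: "enumerate i (map f xs) = map (\<lambda>(i, x). (i, f x)) (enumerate i xs)"
  by (induction xs arbitrary: i) auto

lemma edges_tree: "edges_tree (num n) (num k) CL = enc_pairs (edge_list (inst n k CL))"
  unfolding lst_inject[symmetric] enc_pairs_def lst_enc_list
  by (simp add: edges_tree_def inst_def gadget_def map_concat o_def enumerate_map case_prod_unfold
      vert_eq mul_eq app_num norm_eq term_nums_def if_distrib[of lst] concat_map_filter map_map_filter_len
      add.assoc cong: if_cong)

definition inst_tree :: "tree \<Rightarrow> tree \<Rightarrow> tree \<Rightarrow> tree" where
  "inst_tree N K CL = Node (norm (app (app (app (mul K N) K) CL) (terms CL)))
    (Node (edges_tree N K CL)
    (Node (app (mapt (app (mul K N) K) (\<lambda>_. Leaf)) (app (mapt CL (\<lambda>_. num 2)) (mapt (terms CL) (\<lambda>_. Leaf))))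
          (app (mapt (mul K N) (\<lambda>_. num 2)) (app (mapt K (\<lambda>_. Leaf))
            (app (mapt CL (\<lambda>_. num 2)) (mapt (terms CL) (\<lambda>_. num 1)))))))"

lemma inst_tree: "inst_tree (num n) (num k) CL = enc_inst (inst n k CL)"
proof -
  have "app (mapt (app (mul (num k) (num n)) (num k)) (\<lambda>_. Leaf)) (app (mapt CL (\<lambda>_. num 2)) (mapt (terms CL) (\<lambda>_. Leaf)))
    = enc_nats (lower (inst n k CL))"
    unfolding lst_inject[symmetric]
    by (simp add: inst_def gadget_def mul_eq map_replicate_const replicate_add)
  moreover have "app (mapt (mul (num k) (num n)) (\<lambda>_. num 2)) (app (mapt (num k) (\<lambda>_. Leaf))
            (app (mapt CL (\<lambda>_. num 2)) (mapt (terms CL) (\<lambda>_. num 1))))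
    = enc_nats (upper (inst n k CL))"
    unfolding lst_inject[symmetric]
    by (simp add: inst_def gadget_def mul_eq map_replicate_const)
  moreover have "norm (app (app (app (mul (num k) (num n)) (num k)) CL) (terms CL)) = num (order (inst n k CL))"
    by (simp add: inst_def gadget_def norm_eq mul_eq)
  ultimately show ?thesis unfolding inst_tree_def enc_inst_def edges_tree by simp
qed

lemma inst_rules:
  "wf_inst (inst n k CL)" "bipartite (verts (inst n k CL)) (edges (inst n k CL))" "param (inst n k CL) = k"
  unfolding inst_def by (auto intro!: wf_gadget bipartite_gadget param_gadget dest: terms_less)

lemma BERD_inst: "(enc_inst (inst n k CL), param (inst n k CL)) \<in> BERD \<longleftrightarrow>
    (\<exists>\<sigma>. (\<forall>i<k. \<sigma> i < n) \<and> cnf (picked n k \<sigma>) CL)"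
proof
  assume "(enc_inst (inst n k CL), param (inst n k CL)) \<in> BERD"
  then obtain g where "minimal_rdf (verts (inst n k CL)) (edges (inst n k CL)) g"
    "\<And>v. v \<in> verts (inst n k CL) \<Longrightarrow> lower (inst n k CL) ! v \<le> g v \<and> g v \<le> upper (inst n k CL) ! v"
    unfolding BERD_iff by blast
  from gadget_sound[OF _ this[unfolded inst_def], OF terms_less]
  obtain \<sigma> where "\<forall>i<k. \<sigma> i < n" "\<forall>c<len CL. \<exists>(c', S)\<in>set (map (term_nums (k * n)) (lst (terms CL))).
      c' = c \<and> (\<forall>i<k. i * n + \<sigma> i \<notin> set S)" by blast
  then show "\<exists>\<sigma>. (\<forall>i<k. \<sigma> i < n) \<and> cnf (picked n k \<sigma>) CL" using terms_iff_cnf[of k \<sigma> n CL] by blast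
next
  assume "\<exists>\<sigma>. (\<forall>i<k. \<sigma> i < n) \<and> cnf (picked n k \<sigma>) CL"
  then obtain \<sigma> where \<sigma>: "\<And>i. i < k \<Longrightarrow> \<sigma> i < n" and "cnf (picked n k \<sigma>) CL" by blast
  then have "\<forall>c<len CL. \<exists>(c', S)\<in>set (map (term_nums (k * n)) (lst (terms CL))).
      c' = c \<and> (\<forall>i<k. i * n + \<sigma> i \<notin> set S)" 
    using terms_iff_cnf[of k \<sigma> n CL, OF \<sigma>] by (simp only:)
  then have "\<exists>g. minimal_rdf (verts (inst n k CL)) (edges (inst n k CL)) g \<and>
      (\<forall>v\<in>verts (inst n k CL). lower (inst n k CL) ! v \<le> g v \<and> g v \<le> upper (inst n k CL) ! v)"
    unfolding inst_def by (intro gadget_complete[OF terms_less \<sigma>]) (assumption | blast)+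
  then show "(enc_inst (inst n k CL), param (inst n k CL)) \<in> BERD"
    unfolding BERD_iff using inst_rules(1) by blast
qed

text \<open>One clause without terms: its vertex is isolated and forced to 2, so it could be lowered
  to 1. The final \<open>Leaf\<close> is the parameter 0.\<close>

definition no_inst :: tree where
  "no_inst = Node (enc_inst (inst 0 0 (sing Leaf))) Leaf"

lemma no_inst: "(enc_inst (inst 0 0 (sing Leaf)), param (inst 0 0 (sing Leaf))) \<notin> BERD"
  unfolding BERD_inst by (simp add: dnf_def)

definition reduction :: "nat \<Rightarrow> tree \<Rightarrow> tree" where
  "reduction d z = (if circuit_ok (left z) \<and> output_form d (left z) (right z) \<noteq> Leaf
    then Node (inst_tree (left (left z)) (right z)
      (clauses (left (left z)) (right z) (output_form d (left z) (right z)))) (right z)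
    else no_inst)"

lemma WCS_iff_BERD:
  fixes d k :: nat
  assumes wf: "wf_circuit C"
  defines "a \<equiv> output_form d (enc_circuit C) (num k)"
  defines "J \<equiv> inst (inputs C) k (clauses (num (inputs C)) (num k) a)"
  shows "a = Leaf \<longleftrightarrow> \<not> (depth C \<le> d \<and> weft C \<le> 1)"
    and "a \<noteq> Leaf \<Longrightarrow> (enc_circuit C, k) \<in> WCS 1 d \<longleftrightarrow> (enc_inst J, param J) \<in> BERD"
proof -
  let ?n = "inputs C"
  have form: "form (picked ?n k \<sigma>) (depth C \<le> d) (weft C) (satisfies (\<sigma> ` {..<k}) C) a"
    if "\<And>i. i < k \<Longrightarrow> \<sigma> i < ?n" for \<sigma>
    unfolding a_def by (rule form_output[OF wf that])
  \<comment> \<open>Being an error does not depend on the picks. The constant 0 is a legal choice,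
    as there is at least one input.\<close>
  show 1: "a = Leaf \<longleftrightarrow> \<not> (depth C \<le> d \<and> weft C \<le> 1)"
    using form_Leaf[OF form[of "\<lambda>_. 0"]] wf_circuit_inputs[OF wf] by simp
  assume a: "a \<noteq> Leaf"
  have *: "cnf (picked ?n k \<sigma>) (clauses (num ?n) (num k) a) \<longleftrightarrow>
      satisfies (\<sigma> ` {..<k}) C \<and> inj_on \<sigma> {..<k}" if "\<And>i. i < k \<Longrightarrow> \<sigma> i < ?n" for \<sigma>
    using form_upgrade[OF form[OF that] a] cnf_distinct[OF that] by (simp add: clauses_def)
  have "(\<exists>A \<subseteq> {..<?n}. card A = k \<and> satisfies A C) \<longleftrightarrow>
      (\<exists>\<sigma>. (\<forall>i<k. \<sigma> i < ?n) \<and> satisfies (\<sigma> ` {..<k}) C \<and> inj_on \<sigma> {..<k})"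
  proof
    assume "\<exists>A \<subseteq> {..<?n}. card A = k \<and> satisfies A C"
    then obtain A where A: "A \<subseteq> {..<?n}" "card A = k" "satisfies A C" by blast
    then obtain \<sigma> where "bij_betw \<sigma> {0..<k} A"
      using ex_bij_betw_nat_finite[of A] finite_subset by blast
    then have \<sigma>: "inj_on \<sigma> {..<k}" "\<sigma> ` {..<k} = A"
      by (auto simp: bij_betw_def atLeast0LessThan)
    then show "\<exists>\<sigma>. (\<forall>i<k. \<sigma> i < ?n) \<and> satisfies (\<sigma> ` {..<k}) C \<and> inj_on \<sigma> {..<k}"
      using A by (intro exI[of _ \<sigma>]) auto
  next
    assume "\<exists>\<sigma>. (\<forall>i<k. \<sigma> i < ?n) \<and> satisfies (\<sigma> ` {..<k}) C \<and> inj_on \<sigma> {..<k}"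
    then obtain \<sigma> where "\<forall>i<k. \<sigma> i < ?n" "satisfies (\<sigma> ` {..<k}) C" "inj_on \<sigma> {..<k}" by blast
    then show "\<exists>A \<subseteq> {..<?n}. card A = k \<and> satisfies A C"
      by (intro exI[of _ "\<sigma> ` {..<k}"]) (auto simp: card_image)
  qed
  then show "(enc_circuit C, k) \<in> WCS 1 d \<longleftrightarrow> (enc_inst J, param J) \<in> BERD"
    unfolding WCS_iff J_def BERD_inst using wf 1 a * by blast
qed

text \<open>The parameter stays \<open>k\<close> if a form of the output exists and is 0 for the
  fixed no-instance, hence the inequality.\<close>

lemma reduction_correct:
  "\<exists>J. reduction d (Node x (num k)) = Node (enc_inst J) (num (param J)) \<and> param J \<le> k \<and>
    (enc_inst J, param J) \<in> bipartite_instances \<and> ((x, k) \<in> WCS 1 d \<longleftrightarrow> (enc_inst J, param J) \<in> BERD)"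
proof (cases "circuit_ok x \<and> output_form d x (num k) \<noteq> Leaf")
  case True
  then obtain C where C: "x = enc_circuit C" "wf_circuit C" using circuit_ok by blast
  let ?J = "inst (inputs C) k (clauses (num (inputs C)) (num k) (output_form d x (num k)))"
  have "reduction d (Node x (num k)) = Node (enc_inst ?J) (num k)"
    using True unfolding reduction_def by (simp add: C(1) inst_tree enc_circuit_def)
  then show ?thesis using WCS_iff_BERD(2)[OF C(2), of d k] True
    unfolding bipartite_instances_def
    by (intro exI[of _ ?J]) (auto simp: inst_rules C(1) intro!: exI[of _ ?J])
next
  case False
  let ?J = "inst 0 0 (sing Leaf)"
  have "(x, k) \<notin> WCS 1 d"
  proof
    assume W: "(x, k) \<in> WCS 1 d"
    then obtain C where C: "x = enc_circuit C" "wf_circuit C" "weft C \<le> 1" "depth C \<le> d"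
      unfolding WCS_def by blast
    then have "circuit_ok x" using circuit_ok by blast
    then show False using False WCS_iff_BERD(1)[OF C(2), of d k] C by blast
  qed
  moreover have "reduction d (Node x (num k)) = Node (enc_inst ?J) (num (param ?J))"
    using False unfolding reduction_def left.simps right.simps
    by (subst if_not_P) (simp_all add: no_inst_def inst_rules)
  ultimately show ?thesis using no_inst
    unfolding bipartite_instances_def
    by (intro exI[of _ ?J]) (auto simp: inst_rules intro!: exI[of _ ?J])
qed

section \<open>The reduction runs in polynomial time\<close>

lemmas ptime_rules = ptime_id ptime_const ptime_left ptime_right ptime_Node ptime_If ptime_bind ptime_mapt
  ptime_app ptime_sing ptime_nth_tree ptime_norm ptime_mul ptime_enumt ptime_range_tree
  pdec_Leaf pdec_not pdec_conj pdec_disj pdec_ball pdec_bex pdec_is_unary pdec_len_less pdec_len_eq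

lemma ptime_vert: "ptime F \<Longrightarrow> ptime G \<Longrightarrow> ptime H \<Longrightarrow> ptime (\<lambda>x. vert (F x) (G x) (H x))"
  unfolding vert_def by (intro ptime_rules)

text \<open>Below a \<open>bind\<close> the argument turns into \<open>left y\<close>, where an
  assumption \<open>ptime F\<close> does not apply directly. With projections as arguments the
  closure rules suffice; general arguments are substituted afterwards.\<close>

lemma ptime_along:
  assumes "ptime (\<lambda>y. f (left y) (left (right y)) (right (right y)))" "ptime F" "ptime G" "ptime H"
  shows "ptime (\<lambda>x. f (F x) (G x) (H x))"
  using ptime_comp[OF assms(1) ptime_Node[OF assms(2) ptime_Node[OF assms(3,4)]]] by simp

lemma ptime_along2:
  assumes "ptime (\<lambda>y. f (left y) (right y))" "ptime F" "ptime G"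
  shows "ptime (\<lambda>x. f (F x) (G x))"
  using ptime_comp[OF assms(1) ptime_Node[OF assms(2,3)]] by simp

lemma ptime_input_form:
  assumes "ptime F" "ptime G" "ptime H" shows "ptime (\<lambda>x. input_form (F x) (G x) (H x))"
  by (rule ptime_along[of input_form, OF _ assms]) (unfold input_form_def, intro ptime_rules ptime_vert)

lemma ptime_pos: "ptime F \<Longrightarrow> ptime (\<lambda>x. pos (F x))"
  unfolding pos_def by (intro ptime_rules)

lemma ptime_neg: "ptime F \<Longrightarrow> ptime (\<lambda>x. neg (F x))"
  unfolding neg_def by (intro ptime_rules)

lemma ptime_negate: "ptime F \<Longrightarrow> ptime (\<lambda>x. negate (F x))"
  unfolding negate_def by (intro ptime_rules ptime_pos ptime_neg)

lemma ptime_upgrade: "ptime F \<Longrightarrow> ptime (\<lambda>x. upgrade (F x))"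
  unfolding upgrade_def by (intro ptime_rules ptime_pos ptime_neg)

lemma ptime_cross:
  assumes "ptime F" "ptime G" shows "ptime (\<lambda>x. cross (F x) (G x))"
  by (rule ptime_along2[of cross, OF _ assms]) (unfold cross_def, intro ptime_rules)

lemma ptime_and2: "ptime F \<Longrightarrow> ptime G \<Longrightarrow> ptime (\<lambda>x. and2 (F x) (G x))"
  unfolding and2_def by (intro ptime_rules ptime_pos ptime_neg ptime_upgrade ptime_cross)

lemma ptime_conj_forms: "ptime F \<Longrightarrow> ptime (\<lambda>x. conj_forms (F x))"
  unfolding conj_forms_def by (intro ptime_rules ptime_pos ptime_neg ptime_and2)

lemma ptime_gate_ins: "ptime F \<Longrightarrow> ptime (\<lambda>x. gate_ins (F x))"
  unfolding gate_ins_def by (intro ptime_rules)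

lemma ptime_gate_form:
  assumes "ptime F" "ptime G" shows "ptime (\<lambda>x. gate_form (F x) (G x))"
  by (rule ptime_along2[of gate_form, OF _ assms])
    (unfold gate_form_def, intro ptime_rules ptime_negate ptime_conj_forms ptime_gate_ins)

text \<open>\<open>r\<close> is fixed in the program, and each round applies a polynomial-time step
  to the previous table; the exponent may grow with \<open>r\<close>.\<close>

lemma ptime_table:
  "ptime (\<lambda>y. table r (left y) (left (right y)) (right (right y)))"
proof (induction r)
  case 0
  show ?case unfolding table.simps by (intro ptime_rules ptime_input_form)
next
  case (Suc r)
  have *: "ptime (\<lambda>z. app (mapt (range_tree (left (left z))) (\<lambda>a. input_form (left (left z)) (left (right (left z))) a))
    (mapt (right (right (left z))) (\<lambda>g. gate_form (right z) g)))"
    by (intro ptime_rules ptime_input_form ptime_gate_form)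
  from ptime_comp[OF * ptime_Node[OF ptime_id Suc]] show ?case
    unfolding table.simps table_step_def by simp
qed

lemma ptime_output_form:
  assumes "ptime F" "ptime G" shows "ptime (\<lambda>x. output_form d (F x) (G x))"
  unfolding output_form_def Let_def
  by (intro ptime_rules ptime_along[of "table d", OF ptime_table] assms)

lemma ptime_clauses:
  assumes "ptime F" "ptime G" "ptime H" shows "ptime (\<lambda>x. clauses (F x) (G x) (H x))"
  by (rule ptime_along[of clauses, OF _ assms])
    (unfold clauses_def distinct_clauses_def, intro ptime_rules ptime_vert ptime_pos ptime_upgrade)

lemma ptime_terms: "ptime F \<Longrightarrow> ptime (\<lambda>x. terms (F x))"
  unfolding terms_def by (intro ptime_rules)

lemma ptime_edges_tree:
  assumes "ptime F" "ptime G" "ptime H" shows "ptime (\<lambda>x. edges_tree (F x) (G x) (H x))"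
  by (rule ptime_along[of edges_tree, OF _ assms])
    (unfold edges_tree_def, intro ptime_rules ptime_vert ptime_terms)

lemma ptime_inst_tree:
  assumes "ptime F" "ptime G" "ptime H" shows "ptime (\<lambda>x. inst_tree (F x) (G x) (H x))"
  by (rule ptime_along[of inst_tree, OF _ assms])
    (unfold inst_tree_def, intro ptime_rules ptime_edges_tree ptime_terms)

lemma pdec_gate_ok:
  assumes "ptime F" "ptime G" shows "pdec (\<lambda>x. gate_ok (F x) (G x))"
  unfolding pdec_def
  by (rule ptime_along2[of "\<lambda>a b. if gate_ok a b then num 1 else Leaf", OF _ assms])
    (unfold gate_ok_def, intro ptime_rules ptime_gate_ins)

lemma pdec_circuit_ok: "pdec (\<lambda>z. circuit_ok (left z))"
  unfolding circuit_ok_def by (intro ptime_rules pdec_gate_ok)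

lemma ptime_reduction: "ptime (reduction d)"
  unfolding reduction_def
  by (intro ptime_rules pdec_circuit_ok ptime_output_form ptime_inst_tree ptime_clauses)

section \<open>Composition of reductions\<close>

primrec expr_bound :: "expr \<Rightarrow> nat" where
  "expr_bound (Var i) = Suc i"
| "expr_bound ELeaf = 0"
| "expr_bound (ENode a b) = max (expr_bound a) (expr_bound b)"
| "expr_bound (ELeft a) = expr_bound a"
| "expr_bound (ERight a) = expr_bound a"

primrec prog_bound :: "prog \<Rightarrow> nat" where
  "prog_bound (Assign i e) = max (Suc i) (expr_bound e)"
| "prog_bound (Seq p q) = max (prog_bound p) (prog_bound q)"
| "prog_bound (Cond e p q) = max (expr_bound e) (max (prog_bound p) (prog_bound q))"
| "prog_bound (While e p) = max (expr_bound e) (prog_bound p)"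

lemma val_cong: "expr_bound e \<le> M \<Longrightarrow> (\<And>i. i < M \<Longrightarrow> s i = s' i) \<Longrightarrow> val e s = val e s'"
  by (induction e) auto

text \<open>Only registers below \<open>prog_bound\<close> are read or written, so the others may
  hold any values \<open>r\<close>. This lets data survive the run of an arbitrary program.\<close>

lemma exec_frame:
  assumes "exec p s t s'" "prog_bound p \<le> M"
  shows "exec p (\<lambda>i. if i < M then s i else r i) t (\<lambda>i. if i < M then s' i else r i)"
  using assms
proof (induction rule: exec.induct)
  case (Assign i e s)
  let ?s = "\<lambda>i. if i < M then s i else r i"
  have v: "val e ?s = val e s" using Assign by (intro val_cong[of _ M]) auto
  have "(\<lambda>j. if j < M then (s(i := val e s)) j else r j) = ?s(i := val e ?s)"
    unfolding v using Assign by auto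
  then show ?case using exec.Assign[of i e ?s] unfolding v by metis
next
  case (Seq c1 s t1 s1 c2 t2 s2)
  then show ?case by (auto intro: exec.Seq)
next
  case (CondTrue e s c1 t s' c2)
  have "val e (\<lambda>i. if i < M then s i else r i) = val e s"
    using CondTrue.prems by (intro val_cong[of _ M]) auto
  then show ?case using CondTrue exec.CondTrue[of e "\<lambda>i. if i < M then s i else r i"] by simp
next
  case (CondFalse e s c2 t s' c1)
  have "val e (\<lambda>i. if i < M then s i else r i) = val e s"
    using CondFalse.prems by (intro val_cong[of _ M]) auto
  then show ?case using CondFalse exec.CondFalse[of e "\<lambda>i. if i < M then s i else r i"] by simp
next
  case (WhileFalse e s c)
  have "val e (\<lambda>i. if i < M then s i else r i) = val e s"
    using WhileFalse.prems by (intro val_cong[of _ M]) auto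
  then show ?case using WhileFalse exec.WhileFalse[of e "\<lambda>i. if i < M then s i else r i"] by simp
next
  case (WhileTrue e s c t1 s1 t2 s2)
  have "val e (\<lambda>i. if i < M then s i else r i) = val e s"
    using WhileTrue.prems by (intro val_cong[of _ M]) auto
  then show ?case using WhileTrue exec.WhileTrue[of e "\<lambda>i. if i < M then s i else r i" c t1] by simp
qed

text \<open>A loop whose test is always \<open>Leaf\<close> stands in for the missing skip
  command.\<close>

primrec clear_regs :: "nat \<Rightarrow> prog" where
  "clear_regs 0 = While ELeaf (Assign 0 ELeaf)"
| "clear_regs (Suc m) = Seq (clear_regs m) (Assign (Suc m) ELeaf)"

lemma runs_in_clear: "runs_in (clear_regs m) s (\<lambda>i. if 0 < i \<and> i \<le> m then Leaf else s i) (1 + 2 * m)"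
proof (induction m)
  case 0
  have "(\<lambda>i. if 0 < i \<and> i \<le> 0 then Leaf else s i) = s" by auto
  then show ?case using runs_in_While_stop[of ELeaf s] by simp
next
  case (Suc m)
  let ?s = "\<lambda>i. if 0 < i \<and> i \<le> m then Leaf else s i"
  have "?s(Suc m := Leaf) = (\<lambda>i. if 0 < i \<and> i \<le> Suc m then Leaf else s i)" by auto
  then show ?case using runs_in_Seq[OF Suc runs_in_Assign[of "Suc m" ELeaf]] by simp
qed

text \<open>\<open>computes\<close> presupposes empty work registers, which a preceding arbitrary
  program does not guarantee; clearing them costs a constant.\<close>

lemma ptime_after:
  assumes "ptime F"
  obtains q C c where "\<And>s. \<exists>s'. runs_in q s s' (C + (1 + tsize (s 0)) ^ c) \<and> s' 0 = F (s 0)"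
proof -
  obtain q m c where q: "computes q m F (\<lambda>x. (1 + tsize x) ^ c)" using assms ptimeE by blast
  have "\<exists>s'. runs_in (Seq (clear_regs m) q) s s' ((1 + 2 * m) + (1 + tsize (s 0)) ^ c) \<and> s' 0 = F (s 0)" for s
  proof -
    let ?s = "\<lambda>i. if 0 < i \<and> i \<le> m then Leaf else s i"
    have "fclean m ?s" by (simp add: fclean_def)
    then have "runs_in q ?s (?s(0 := F (?s 0))) ((1 + tsize (?s 0)) ^ c)"
      using q unfolding computes_def by blast
    from runs_in_Seq[OF runs_in_clear this] show ?thesis by (intro exI[of _ "?s(0 := F (s 0))"]) simp
  qed
  then show thesis by (rule that)
qed

text \<open>This serves to show that the time bound of a composed reduction is computable. While
  \<open>p\<close> runs, \<open>n\<close> is kept in a register beyond those of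
  \<open>p\<close>.\<close>

lemma computable_comp:
  assumes f: "computable f" and H: "ptime H" "\<And>n v. H (Node (num n) (num v)) = num (h n v)"
  shows "computable (\<lambda>n. h n (f n))"
proof -
  obtain p where p: "\<And>n. \<exists>t. runs p (num n) t (num (f n))" using f unfolding computable_def by blast
  obtain q C c where q: "\<And>s. \<exists>s'. runs_in q s s' (C + (1 + tsize (s 0)) ^ c) \<and> s' 0 = H (s 0)"
    using ptime_after[OF H(1)] by metis
  let ?M = "Suc (prog_bound p)"
  let ?prog = "Seq (Assign ?M (Var 0)) (Seq p (Seq (Assign 0 (ENode (Var ?M) (Var 0))) q))"
  have "\<exists>t. runs ?prog (num n) t (num (h n (f n)))" for n
  proof -
    let ?s0 = "(\<lambda>_. Leaf)(0 := num n)"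
    obtain t s1 where t: "exec p ?s0 t s1" "s1 0 = num (f n)" using p[of n] unfolding runs_def by blast
    let ?r = "(\<lambda>_. Leaf)(?M := num n)"
    let ?s2 = "\<lambda>i. if i < ?M then s1 i else ?r i"
    have 1: "exec (Assign ?M (Var 0)) ?s0 (1 + tsize (num n)) (\<lambda>i. if i < ?M then ?s0 i else ?r i)"
    proof -
      have "(\<lambda>i. if i < ?M then ?s0 i else ?r i) = ?s0(?M := val (Var 0) ?s0)" by (auto simp: fun_eq_iff)
      then show ?thesis using exec.Assign[of ?M "Var 0" ?s0] by simp
    qed
    have 2: "exec p (\<lambda>i. if i < ?M then ?s0 i else ?r i) t ?s2"
      by (rule exec_frame[OF t(1)]) simp
    let ?s3 = "?s2(0 := Node (num n) (num (f n)))"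
    have 3: "\<exists>t. exec (Assign 0 (ENode (Var ?M) (Var 0))) ?s2 t ?s3"
      using exec.Assign[of 0 "ENode (Var ?M) (Var 0)" ?s2] t(2) by auto
    have 4: "\<exists>t s'. exec q ?s3 t s' \<and> s' 0 = num (h n (f n))"
      using q[of ?s3] H(2) unfolding runs_in_def by auto
    show ?thesis unfolding runs_def using 1 2 3 4 exec.Seq by meson
  qed
  then show ?thesis unfolding computable_def by blast
qed

section \<open>Time bounds of composed reductions\<close>

primrec pow_tree :: "nat \<Rightarrow> tree \<Rightarrow> tree" where
  "pow_tree 0 t = num 1"
| "pow_tree (Suc c) t = mul t (pow_tree c t)"

lemma pow_tree: "pow_tree c t = num (len t ^ c)"
  by (induction c) (auto simp: mul_eq)

lemma ptime_pow_tree: "ptime F \<Longrightarrow> ptime (\<lambda>x. pow_tree c (F x))"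
  by (induction c) (auto intro: ptime_const ptime_mul simp del: num.simps)

lemma computable_bound:
  assumes "computable f" shows "computable (\<lambda>k. (2 * f k + 2 * k + C) ^ c)"
proof (rule computable_comp[OF assms, where h = "\<lambda>k v. (2 * v + 2 * k + C) ^ c"])
  show "ptime (\<lambda>z. pow_tree c (app (app (right z) (right z)) (app (app (left z) (left z)) (num C))))"
    by (intro ptime_pow_tree ptime_app ptime_left ptime_right ptime_id ptime_const)
qed (simp add: pow_tree mult_2 add_ac)

text \<open>The summand moves into the base, leaving a single power that later splits into a factor
  in \<open>k\<close> and one in the input size.\<close>

lemma add_power_le: "1 \<le> D \<Longrightarrow> a + D ^ b \<le> (a + D) ^ Suc (b::nat)" for a D :: nat
proof -
  assume D: "1 \<le> D"
  have "a * 1 \<le> a * (a + D) ^ b" using D by (intro mult_left_mono) auto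
  moreover have "1 * D ^ b \<le> D * (a + D) ^ b" using D by (intro mult_mono power_mono) auto
  moreover have "(a + D) ^ Suc b = a * (a + D) ^ b + D * (a + D) ^ b" by (simp add: algebra_simps)
  ultimately show ?thesis by linarith
qed

lemma fpt_reduces_into_comp:
  assumes "fpt_reduces L Q" and F: "ptime F"
    and corr: "\<And>x k. \<exists>x' k'. F (Node x (num k)) = Node x' (num k') \<and> k' \<le> k \<and> (x', k') \<in> I \<and>
      ((x, k) \<in> Q \<longleftrightarrow> (x', k') \<in> R)"
  shows "fpt_reduces_into L I R"
proof -
  obtain p f g c where fg: "computable f" "computable g" and
    p: "\<forall>x k. \<exists>x' k' t. runs p (Node x (num k)) t (Node x' (num k')) \<and> t \<le> f k * tsize x ^ c \<and>
      k' \<le> g k \<and> (x', k') \<in> UNIV \<and> ((x, k) \<in> L \<longleftrightarrow> (x', k') \<in> Q)"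
    using assms(1) unfolding fpt_reduces_def fpt_reduces_into_def by blast
  obtain q C b where q: "\<And>s. \<exists>s'. runs_in q s s' (C + (1 + tsize (s 0)) ^ b) \<and> s' 0 = F (s 0)"
    using ptime_after[OF F] by metis
  \<comment> \<open>\<open>t\<close> counts twice, as running time and in the size of the
    intermediate tree, whence \<open>2 * f k\<close>. The unary parameter gives
    \<open>2 * k\<close>, and \<open>C + 4\<close> collects \<open>C\<close>, the constant 3 and one
    unit for \<open>tsize x\<close>.\<close>
  let ?h = "\<lambda>k. (2 * f k + 2 * k + (C + 4)) ^ Suc b"
  have "\<exists>x' k' t. runs (Seq p q) (Node x (num k)) t (Node x' (num k')) \<and>
      t \<le> ?h k * tsize x ^ (Suc c * Suc b) \<and> k' \<le> g k \<and> (x', k') \<in> I \<and> ((x, k) \<in> L \<longleftrightarrow> (x', k') \<in> R)" for x k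
  proof -
    obtain x1 k1 t where 1: "runs p (Node x (num k)) t (Node x1 (num k1))" "t \<le> f k * tsize x ^ c"
      "k1 \<le> g k" "(x, k) \<in> L \<longleftrightarrow> (x1, k1) \<in> Q" using p by metis
    obtain x2 k2 where 2: "F (Node x1 (num k1)) = Node x2 (num k2)" "k2 \<le> k1" "(x2, k2) \<in> I"
      "(x1, k1) \<in> Q \<longleftrightarrow> (x2, k2) \<in> R" using corr by metis
    let ?s = "(\<lambda>_. Leaf)(0 := Node x (num k))"
    obtain s1 where s1: "exec p ?s t s1" "s1 0 = Node x1 (num k1)" using 1(1) unfolding runs_def by blast
    obtain s2 t2 where s2: "exec q s1 t2 s2" "t2 \<le> C + (1 + tsize (s1 0)) ^ b" "s2 0 = Node x2 (num k2)"
      using q[of s1] 2(1) s1(2) unfolding runs_in_def by auto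
    \<comment> \<open>The exponent \<open>Suc c\<close> makes \<open>S\<close> dominate both
      \<open>tsize x\<close> and \<open>tsize x ^ c\<close>, even for \<open>c = 0\<close>.\<close>
    define S where "S = tsize x ^ Suc c"
    have S: "1 \<le> S" "tsize x \<le> S" "tsize x ^ c \<le> S"
      using tsize_pos[of x] unfolding S_def by (auto simp: Suc_le_eq)
    have "tsize (s1 0) \<le> tsize (?s 0) + t"
      using exec_tsize[OF s1(1), of 0] by auto
    then have sz: "tsize (s1 0) \<le> 2 + tsize x + 2 * k + t" by simp
    have "t + t2 \<le> (t + C) + (1 + tsize (s1 0)) ^ b" using s2(2) by simp
    also have "\<dots> \<le> (t + C) + (3 + tsize x + 2 * k + t) ^ b" using sz by (intro add_left_mono power_mono) auto
    also have "\<dots> \<le> (t + C + (3 + tsize x + 2 * k + t)) ^ Suc b" by (rule add_power_le) simp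
    also have "\<dots> \<le> ((2 * f k + 2 * k + (C + 4)) * S) ^ Suc b"
    proof (rule power_mono)
      have "t \<le> f k * S" using 1(2) S(3) by (meson le_trans mult_le_mono2)
      moreover have eq: "(2 * f k + 2 * k + (C + 4)) * S = 2 * (f k * S) + (C + 3 + 2 * k) * S + S"
        by (simp add: algebra_simps)
      moreover have "C + 3 + 2 * k \<le> (C + 3 + 2 * k) * S" using S(1) by simp
      ultimately show "t + C + (3 + tsize x + 2 * k + t) \<le> (2 * f k + 2 * k + (C + 4)) * S"
        using S(2) unfolding eq by linarith
    qed simp
    also have "\<dots> = ?h k * tsize x ^ (Suc c * Suc b)"
      by (simp only: S_def power_mult_distrib power_mult)
    finally have "t + t2 \<le> ?h k * tsize x ^ (Suc c * Suc b)" .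
    moreover have "runs (Seq p q) (Node x (num k)) (t + t2) (Node x2 (num k2))"
      unfolding runs_def using exec.Seq[OF s1(1) s2(1)] s2(3) by blast
    ultimately show ?thesis using 1(3,4) 2(2-4) by (meson le_trans)
  qed
  then show ?thesis unfolding fpt_reduces_into_def using computable_bound[OF fg(1)] fg(2) by blast
qed

theorem theorem11:
  shows "W_hard 1 BERD \<and> W_hard_on 1 bipartite_instances BERD"
proof -
  have *: "fpt_reduces_into L bipartite_instances BERD" if L: "L \<in> W 1" for L
  proof -
    obtain d where "fpt_reduces L (WCS 1 d)" using L unfolding W_def by blast
    from fpt_reduces_into_comp[OF this ptime_reduction] show ?thesis
      using reduction_correct[of d] by metis
  qed
  moreover have "fpt_reduces L BERD" if "L \<in> W 1" for L
    using *[OF that] unfolding fpt_reduces_def fpt_reduces_into_def by (meson UNIV_I)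
  ultimately show ?thesis unfolding W_hard_def W_hard_on_def by blast
qed

end
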